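(* Let $\varrho:\mathbb{R}\to\mathbb{R}$ be a $k$-admissible radial component with control weight $v$, for some $k\in\mathbb{N}$ with $k\ge d+1$. Then there is a constant $C\ge1$, dependent on $\varrho$, $v$, $d$ and $k$, such that with $$v_0:\mathbb{R}^d\to(0,\infty),\qquad\tau\mapsto C\cdot(1+|\tau|)\cdot v(|\tau|),$$ the associated radial warping function $\Phi_\varrho:\mathbb{R}^d\to\mathbb{R}^d$ is a $k$-admissible warping function with control weight $v_0$. Furthermore, the weight $w=\det(\mathrm{D}\Phi_\varrho^{-1})$ is given by $$w(\tau)=\varrho_*'(|\tau|)\cdot[\widetilde{\varrho_*}(|\tau|)]^{d-1}.$$
   Context: Notation. $|\cdot|$ is the Euclidean norm and $\|\cdot\|$ the induced operator norm on matrices. A weight is a measurable function with values in $(0,\infty)$. A weight $v$ on $\mathbb{R}^n$ is submultiplicative if $v(\sigma+\tau)\le v(\sigma)v(\tau)$; radially increasing if $v(\sigma)\le v(\tau)$ whenever $|\sigma|\le|\tau|$; another weight $\tilde v$ is $v$-moderate if $\tilde v(\sigma+\tau)\le v(\sigma)\tilde v(\tau)$ for all $\sigma,\tau$. $k$-admissible radial component ($k\in\mathbb{N}_0$). A function $\varrho:\mathbb{R}\to\mathbb{R}$ is a $k$-admissible radial component with control weight $v:\mathbb{R}\to(0,\infty)$ if: (1) $\varrho$ is a strictly increasing $C^{k+1}$-diffeomorphism with inverse $\varrho_*=\varrho^{-1}$; (2) $\varrho(-\xi)=-\varrho(\xi)$ for all $\xi\in\mathbb{R}$; (3) there are $\varepsilon,c>0$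 with $\varrho(\xi)=c\xi$ for all $\xi\in(-\varepsilon,\varepsilon)$; (4) $v$ is continuous, submultiplicative and radially increasing, and $\varrho_*'$ and $\widetilde{\varrho_*}:\mathbb{R}\to(0,\infty)$, $\widetilde{\varrho_*}(\xi):=\varrho_*(\xi)/\xi$ for $\xi\ne0$, $\widetilde{\varrho_*}(0):=c^{-1}$, are $v$-moderate; (5) there are $C_0,C_1>0$ with $C_0\widetilde{\varrho_*}(\xi)\le\varrho_*'(\xi)\le C_1(1+\xi)\widetilde{\varrho_*}(\xi)$ for all $\xi>0$; (6) $|\varrho_*^{(\ell)}(\xi)|\le v(\xi-\eta)\cdot\varrho_*'(\eta)$ for all $\eta,\xi\in[0,\infty)$ and $\ell\in\{1,\dots,k+1\}$. Associated radial warping function. $\Phi_\varrho:\mathbb{R}^d\to\mathbb{R}^d$, $\Phi_\varrho(\xi)=\widetilde\varrho(|\xi|)\,\xi$, where $\widetilde\varrho(t)=\varrho(t)/t$ for $t\ne0$ and $\widetilde\varrho(0)=c$. $k$-admissible warping function. For $D\subset\mathbb{R}^d$ open and non-empty, $\Phi:D\to\mathbb{R}^d$ is a $k$-admissible warping function with control weight $v_0:\mathbb{R}^d\to(0,\infty)$ if $v_0$ is continuous, submultiplicative and radially increasing, $\Phi$ is a $C^{k+1}$-diffeomorphism (onto $\mathbb{R}^d$), $A:=\mathrm{D}\Phi^{-1}$ has positive determinant everywhere, and with $\phi_\tau(\upsilon):=A^T(\upsilon+\tau)A^{-T}(\tau)$ one has $\|\partial^\alpha\phi_\tau(\upsilon)\|\le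 v_0(\upsilon)$ for all $\tau,\upsilon\in\mathbb{R}^d$ and $\alpha\in\mathbb{N}_0^d$ with $|\alpha|\le k$ (derivatives in $\upsilon$). Here $D=\mathbb{R}^d$. *)

theory Defs
  imports "HOL-Analysis.Analysis"
begin

definition weight :: "('a::euclidean_space \<Rightarrow> real) \<Rightarrow> bool" where
  "weight v \<longleftrightarrow> v \<in> borel_measurable borel \<and> (\<forall>x. 0 < v x)"

definition submultiplicative :: "('a::euclidean_space \<Rightarrow> real) \<Rightarrow> bool" where
  "submultiplicative v \<longleftrightarrow> (\<forall>\<sigma> \<tau>. v (\<sigma> + \<tau>) \<le> v \<sigma> * v \<tau>)"

definition radially_increasing :: "('a::euclidean_space \<Rightarrow> real) \<Rightarrow> bool" where
  "radially_increasing v \<longleftrightarrow> (\<forall>\<sigma> \<tau>. norm \<sigma> \<le> norm \<tau> \<longrightarrow> v \<sigma> \<le> v \<tau>)"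

definition moderate :: "('a::euclidean_space \<Rightarrow> real) \<Rightarrow> ('a \<Rightarrow> real) \<Rightarrow> bool" where
  "moderate v w \<longleftrightarrow> weight w \<and> (\<forall>\<sigma> \<tau>. w (\<sigma> + \<tau>) \<le> v \<sigma> * w \<tau>)"

definition control_weight :: "('a::euclidean_space \<Rightarrow> real) \<Rightarrow> bool" where
  "control_weight v \<longleftrightarrow>
     weight v \<and> continuous_on UNIV v \<and> submultiplicative v \<and> radially_increasing v"

text \<open>\<open>C_diff m S f\<close>: the function \<open>f\<close> is of class \<open>C\<^sup>m\<close> on the open set \<open>S\<close>,
  i.e. all iterated directional derivatives up to order \<open>m\<close> exist and are continuous.\<close>

primrec C_diff ::
  "nat \<Rightarrow> 'a::euclidean_space set \<Rightarrow> ('a \<Rightarrow> 'b::real_normed_vector) \<Rightarrow> bool" where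
  "C_diff 0 S f \<longleftrightarrow> continuous_on S f"
| "C_diff (Suc m) S f \<longleftrightarrow>
     (\<forall>x\<in>S. f differentiable (at x)) \<and>
     (\<forall>u. C_diff m S (\<lambda>x. frechet_derivative f (at x) u))"

definition C_diffeomorphism ::
  "nat \<Rightarrow> 'a::euclidean_space set \<Rightarrow> 'b::euclidean_space set \<Rightarrow> ('a \<Rightarrow> 'b) \<Rightarrow> bool" where
  "C_diffeomorphism m S T f \<longleftrightarrow>
     open S \<and> open T \<and> bij_betw f S T \<and> C_diff m S f \<and> C_diff m T (inv_into S f)"

definition partial_deriv ::
  "'n::finite \<Rightarrow> (real^'n \<Rightarrow> 'b::real_normed_vector) \<Rightarrow> real^'n \<Rightarrow> 'b" where
  "partial_deriv i f x = vector_derivative (\<lambda>t. f (x + t *\<^sub>R axis i 1)) (at 0)"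

text \<open>The derivative \<open>\<partial>\<^sup>\<alpha>\<close> for a multi-index \<open>\<alpha>\<close>. Since the index type \<open>'n\<close> carries no order,
  the order of differentiation is an arbitrary list in which each \<open>i\<close> occurs \<open>\<alpha> i\<close> times;
  for functions of class \<open>C\<^sup>m\<close> with \<open>m \<ge> \<bar>\<alpha>\<bar>\<close>, the only ones used below, this choice is
  irrelevant by symmetry of mixed derivatives.\<close>

definition multi_deriv ::
  "('n::finite \<Rightarrow> nat) \<Rightarrow> (real^'n \<Rightarrow> 'b::real_normed_vector) \<Rightarrow> real^'n \<Rightarrow> 'b" where
  "multi_deriv \<alpha> f =
     foldr partial_deriv (SOME js. \<forall>i. count_list js i = \<alpha> i) f"

text \<open>The constant \<open>c\<close> with \<open>\<rho> \<xi> = c \<xi>\<close> near \<open>0\<close>; it is unique if it exists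
  (lemma \<open>radial_slope_eq\<close>).\<close>

definition radial_slope :: "(real \<Rightarrow> real) \<Rightarrow> real" where
  "radial_slope \<rho> = (THE c. \<exists>\<epsilon>>0. \<forall>\<xi>\<in>{-\<epsilon><..<\<epsilon>}. \<rho> \<xi> = c * \<xi>)"

lemma radial_slope_eq:
  assumes "\<epsilon> > 0" and "\<forall>\<xi>\<in>{-\<epsilon><..<\<epsilon>}. \<rho> \<xi> = c * \<xi>"
  shows "radial_slope \<rho> = c"
  unfolding radial_slope_def
proof (rule the_equality)
  show "\<exists>\<epsilon>>0. \<forall>\<xi>\<in>{-\<epsilon><..<\<epsilon>}. \<rho> \<xi> = c * \<xi>" using assms by blast
next
  fix c' assume "\<exists>\<epsilon>>0. \<forall>\<xi>\<in>{-\<epsilon><..<\<epsilon>}. \<rho> \<xi> = c' * \<xi>"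
  then obtain \<delta> where \<delta>: "\<delta> > 0" "\<forall>\<xi>\<in>{-\<delta><..<\<delta>}. \<rho> \<xi> = c' * \<xi>" by blast
  define t where "t = min \<epsilon> \<delta> / 2"
  have "t > 0" "t < \<epsilon>" "t < \<delta>" using assms(1) \<delta>(1) by (auto simp: t_def min_def)
  then have "c * t = c' * t" using assms(2) \<delta>(2) by (metis greaterThanLessThan_iff minus_less_iff neg_less_0_iff_less order_less_trans)
  with \<open>t > 0\<close> show "c' = c" by simp
qed

definition radial_quot :: "(real \<Rightarrow> real) \<Rightarrow> real \<Rightarrow> real" where
  "radial_quot \<rho> t = (if t = 0 then radial_slope \<rho> else \<rho> t / t)"

definition radial_inv_quot :: "(real \<Rightarrow> real) \<Rightarrow> real \<Rightarrow> real" where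
  "radial_inv_quot \<rho> \<xi> = (if \<xi> = 0 then inverse (radial_slope \<rho>) else inv \<rho> \<xi> / \<xi>)"

definition admissible_radial_component ::
  "nat \<Rightarrow> (real \<Rightarrow> real) \<Rightarrow> (real \<Rightarrow> real) \<Rightarrow> bool" where
  "admissible_radial_component k \<rho> v \<longleftrightarrow>
     strict_mono \<rho> \<and> C_diffeomorphism (k + 1) UNIV UNIV \<rho> \<and>
     (\<forall>\<xi>. \<rho> (- \<xi>) = - \<rho> \<xi>) \<and>
     (\<exists>\<epsilon>>0. \<exists>c>0. \<forall>\<xi>\<in>{-\<epsilon><..<\<epsilon>}. \<rho> \<xi> = c * \<xi>) \<and>
     control_weight v \<and> moderate v (deriv (inv \<rho>)) \<and> moderate v (radial_inv_quot \<rho>) \<and>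
     (\<exists>C\<^sub>0>0. \<exists>C\<^sub>1>0. \<forall>\<xi>>0.
        C\<^sub>0 * radial_inv_quot \<rho> \<xi> \<le> deriv (inv \<rho>) \<xi> \<and>
        deriv (inv \<rho>) \<xi> \<le> C\<^sub>1 * (1 + \<xi>) * radial_inv_quot \<rho> \<xi>) \<and>
     (\<forall>\<eta>\<ge>0. \<forall>\<xi>\<ge>0. \<forall>l\<in>{1..k + 1}.
        \<bar>(deriv ^^ l) (inv \<rho>) \<xi>\<bar> \<le> v (\<xi> - \<eta>) * deriv (inv \<rho>) \<eta>)"

definition radial_warping :: "(real \<Rightarrow> real) \<Rightarrow> real^'n::finite \<Rightarrow> real^'n" where
  "radial_warping \<rho> \<xi> = radial_quot \<rho> (norm \<xi>) *\<^sub>R \<xi>"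

text \<open>The Jacobian matrix \<open>A = D\<Phi>\<^sup>-\<^sup>1\<close> and the map \<open>\<phi>\<^sub>\<tau>(\<upsilon>) = A\<^sup>T(\<upsilon> + \<tau>) A\<^sup>-\<^sup>T(\<tau>)\<close>.\<close>

definition inv_jacobian ::
  "(real^'n::finite) set \<Rightarrow> (real^'n \<Rightarrow> real^'n) \<Rightarrow> real^'n \<Rightarrow> real^'n^'n" where
  "inv_jacobian D \<Phi> \<tau> = jacobian (inv_into D \<Phi>) (at \<tau>)"

definition warping_phi ::
  "(real^'n::finite) set \<Rightarrow> (real^'n \<Rightarrow> real^'n) \<Rightarrow> real^'n \<Rightarrow> real^'n \<Rightarrow> real^'n^'n" where
  "warping_phi D \<Phi> \<tau> \<upsilon> =
     transpose (inv_jacobian D \<Phi> (\<upsilon> + \<tau>)) ** matrix_inv (transpose (inv_jacobian D \<Phi> \<tau>))"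

definition admissible_warping ::
  "nat \<Rightarrow> (real^'n::finite) set \<Rightarrow> (real^'n \<Rightarrow> real^'n) \<Rightarrow> (real^'n \<Rightarrow> real) \<Rightarrow> bool" where
  "admissible_warping k D \<Phi> v\<^sub>0 \<longleftrightarrow>
     open D \<and> D \<noteq> {} \<and> control_weight v\<^sub>0 \<and>
     C_diffeomorphism (k + 1) D UNIV \<Phi> \<and>
     (\<forall>\<tau>. 0 < det (inv_jacobian D \<Phi> \<tau>)) \<and>
     (\<forall>\<tau> \<upsilon> \<alpha>. (\<Sum>i\<in>UNIV. \<alpha> i) \<le> k \<longrightarrow>
        onorm ((*v) (multi_deriv \<alpha> (warping_phi D \<Phi> \<tau>) \<upsilon>)) \<le> v\<^sub>0 \<upsilon>)"

end

theory Submission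
  imports Defs
begin

section \<open>Radial warping functions are admissible\<close>

text \<open>Let \<open>h\<close> be the inverse of \<open>\<rho>\<close> and \<open>g t = h t / t\<close>. The inverse of the warping function is
  \<open>\<Psi> x = g \<bar>x\<bar> x\<close>, whose Jacobian \<open>A x\<close> has the eigenvalue \<open>h' \<bar>x\<bar>\<close> on the line through \<open>x\<close> and
  \<open>g \<bar>x\<bar>\<close> on its orthogonal complement; this gives the determinant. Away from the origin, a
  partial derivative of \<open>A\<close> of order \<open>n\<close> is the derivative of \<open>h\<close> of order \<open>n + 1\<close> at \<open>\<bar>x\<bar>\<close> times a
  bounded multiple of the projection onto the line through \<open>x\<close>, plus derivatives of \<open>h\<close> of order
  at most \<open>n\<close> times factors \<open>O(1 / \<bar>x\<bar>)\<close>. To bound such a derivative at \<open>\<sigma>\<close> composed with the inverse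
  of \<open>A \<tau>\<close>, note that the inverse has norm \<open>O(1 / g \<bar>\<tau>\<bar>)\<close> and that \<open>h' / g\<close> grows at most linearly. The
  factor \<open>O(1 / \<bar>\<sigma>\<bar>)\<close> absorbs this growth in the lower order terms. In the leading term, unit vectors
  orthogonal to \<open>\<tau>\<close> have a component of size at most \<open>\<bar>\<sigma> - \<tau>\<bar> / \<bar>\<sigma>\<bar>\<close> along \<open>\<sigma>\<close>, which accounts for
  the factor \<open>1 + \<bar>\<sigma> - \<tau>\<bar>\<close> of the control weight.\<close>

subsection \<open>Functions of class \<open>C\<^sup>m\<close>\<close>

text \<open>\<open>frechet_derivative\<close> is a choice among all derivatives at the point. On an
  open set \<open>f\<close> and \<open>g\<close> have the same derivatives, so the choices coincide
  even without differentiability.\<close>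

lemma frechet_derivative_cong_open:
  assumes "open S" "x \<in> S" "\<And>y. y \<in> S \<Longrightarrow> f y = g y"
  shows "frechet_derivative f (at x) = frechet_derivative g (at x)"
proof -
  have "(f has_derivative D) (at x) \<longleftrightarrow> (g has_derivative D) (at x)" for D
    using assms has_derivative_transform_within_open[of f D x UNIV S g]
      has_derivative_transform_within_open[of g D x UNIV S f] by auto
  then show ?thesis by (simp add: frechet_derivative_def)
qed

lemma C_diff_cong_open:
  assumes "open S" "\<And>x. x \<in> S \<Longrightarrow> f x = g x" "C_diff m S f"
  shows "C_diff m S g"
  using assms(2,3)
proof (induction m arbitrary: f g)
  case 0
  then show ?case by (simp cong: continuous_on_cong)
next
  case (Suc m)
  have D: "frechet_derivative f (at x) = frechet_derivative g (at x)" if "x \<in> S" for x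
    using frechet_derivative_cong_open[OF assms(1) that] Suc.prems(1) by blast
  have "g differentiable (at x)" if "x \<in> S" for x
  proof -
    have "(f has_derivative frechet_derivative f (at x)) (at x)"
      using Suc.prems(2) that by (simp add: frechet_derivative_works)
    then have "(g has_derivative frechet_derivative f (at x)) (at x)"
      by (rule has_derivative_transform_within_open[OF _ assms(1) that Suc.prems(1)])
    then show ?thesis by (rule differentiableI)
  qed
  moreover have "C_diff m S (\<lambda>x. frechet_derivative g (at x) u)" for u
    by (rule Suc.IH[where f = "\<lambda>x. frechet_derivative f (at x) u"]) (use D Suc.prems in auto)
  ultimately show ?case by simp
qed

text \<open>The closure proofs below use this to work with an explicit derivative formula
  \<open>f'\<close> in place of \<open>frechet_derivative\<close>.\<close>

lemma C_diff_SucI: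
  assumes "open S" "\<And>x. x \<in> S \<Longrightarrow> (f has_derivative f' x) (at x)"
    and "\<And>u. C_diff m S (\<lambda>x. f' x u)"
  shows "C_diff (Suc m) S f"
proof -
  have "C_diff m S (\<lambda>x. frechet_derivative f (at x) u)" for u
    by (rule C_diff_cong_open[OF assms(1) _ assms(3)[of u]])
       (simp add: frechet_derivative_at[OF assms(2), symmetric])
  then show ?thesis using assms(2) by (auto intro: differentiableI)
qed

lemma C_diff_Suc_has_derivative:
  "C_diff (Suc m) S f \<Longrightarrow> x \<in> S \<Longrightarrow> (f has_derivative frechet_derivative f (at x)) (at x)"
  by (simp add: frechet_derivative_works)

lemma C_diff_SucD: "C_diff (Suc m) S f \<Longrightarrow> C_diff m S f"
proof (induction m arbitrary: f)
  case 0
  then show ?case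
    by (auto intro!: continuous_at_imp_continuous_on differentiable_imp_continuous_within)
qed auto

lemma C_diff_Un:
  "open S \<Longrightarrow> open T \<Longrightarrow> C_diff m S f \<Longrightarrow> C_diff m T f \<Longrightarrow> C_diff m (S \<union> T) f"
  by (induction m arbitrary: f) (auto intro: continuous_on_open_Un)

lemma C_diff_const: "open S \<Longrightarrow> C_diff m S (\<lambda>x. c)"
  by (induction m arbitrary: c) (auto intro!: C_diff_SucI derivative_eq_intros simp del: C_diff.simps(2))

lemma C_diff_bounded_linear:
  assumes "open S" "bounded_linear f"
  shows "C_diff m S f"
proof (cases m)
  case 0
  then show ?thesis using assms by (simp add: linear_continuous_on)
next
  case (Suc n)
  have "C_diff (Suc n) S f"
    by (rule C_diff_SucI[OF assms(1) bounded_linear_imp_has_derivative[OF assms(2)]])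
      (rule C_diff_const[OF assms(1)])
  then show ?thesis using Suc by simp
qed

lemma C_diff_add:
  assumes "open S" "C_diff m S f" "C_diff m S g"
  shows "C_diff m S (\<lambda>x. f x + g x)"
  using assms(2,3)
proof (induction m arbitrary: f g)
  case 0
  then show ?case by (simp add: continuous_on_add)
next
  case (Suc m)
  show ?case
  proof (rule C_diff_SucI[OF assms(1)])
    show "((\<lambda>x. f x + g x) has_derivative
       (\<lambda>u. frechet_derivative f (at x) u + frechet_derivative g (at x) u)) (at x)" if "x \<in> S" for x
      using that Suc.prems by (intro has_derivative_add C_diff_Suc_has_derivative)
    show "C_diff m S (\<lambda>x. frechet_derivative f (at x) u + frechet_derivative g (at x) u)" for u
      using Suc by auto
  qed
qed

lemma C_diff_scaleR:
  fixes f :: "'a::euclidean_space \<Rightarrow> real"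
  assumes "open S" "C_diff m S f" "C_diff m S g"
  shows "C_diff m S (\<lambda>x. f x *\<^sub>R g x)"
  using assms(2,3)
proof (induction m arbitrary: f g)
  case 0
  then show ?case by (simp add: continuous_on_scaleR)
next
  case (Suc m)
  show ?case
  proof (rule C_diff_SucI[OF assms(1)])
    show "((\<lambda>x. f x *\<^sub>R g x) has_derivative
       (\<lambda>u. f x *\<^sub>R frechet_derivative g (at x) u + frechet_derivative f (at x) u *\<^sub>R g x)) (at x)"
      if "x \<in> S" for x
      using that Suc.prems by (intro has_derivative_scaleR C_diff_Suc_has_derivative)
    show "C_diff m S (\<lambda>x. f x *\<^sub>R frechet_derivative g (at x) u + frechet_derivative f (at x) u *\<^sub>R g x)" for u
      using C_diff_SucD[OF Suc.prems(1)] C_diff_SucD[OF Suc.prems(2)] Suc.prems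
      by (intro C_diff_add[OF assms(1)] Suc.IH) auto
  qed
qed

text \<open>For a real inner function, the derivative of \<open>g\<close> at \<open>f x\<close> is
  determined by its value at 1. The chain rule then gives a scalar multiple of another composition
  with \<open>f\<close>, which the induction hypothesis covers.\<close>

lemma C_diff_compose_real:
  fixes f :: "'a::euclidean_space \<Rightarrow> real"
  assumes "open S" "f ` S \<subseteq> T" "C_diff m T g" "C_diff m S f"
  shows "C_diff m S (\<lambda>x. g (f x))"
  using assms(3,4)
proof (induction m arbitrary: g)
  case 0
  then show ?case using assms(2) by (auto intro: continuous_on_compose2)
next
  case (Suc m)
  show ?case
  proof (rule C_diff_SucI[OF assms(1)])
    fix x assume x: "x \<in> S"
    have g: "(g has_derivative frechet_derivative g (at (f x))) (at (f x))"
      using x assms(2) by (intro C_diff_Suc_has_derivative[OF Suc.prems(1)]) auto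
    have lin: "frechet_derivative g (at (f x)) y = y *\<^sub>R frechet_derivative g (at (f x)) 1" for y
      using linear_scale[OF has_derivative_linear[OF g], of y 1] by simp
    have "((\<lambda>x. g (f x)) has_derivative
        (\<lambda>u. frechet_derivative g (at (f x)) (frechet_derivative f (at x) u))) (at x)"
      by (rule has_derivative_compose[OF C_diff_Suc_has_derivative[OF Suc.prems(2) x] g])
    then show "((\<lambda>x. g (f x)) has_derivative
        (\<lambda>u. frechet_derivative f (at x) u *\<^sub>R frechet_derivative g (at (f x)) 1)) (at x)"
      by (rule has_derivative_eq_rhs) (rule ext, rule lin)
  next
    show "C_diff m S (\<lambda>x. frechet_derivative f (at x) u *\<^sub>R frechet_derivative g (at (f x)) 1)" for u
      proof (rule C_diff_scaleR[OF assms(1)])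
      show "C_diff m S (\<lambda>x. frechet_derivative f (at x) u)"
        using Suc.prems(2) by simp
      have "C_diff m T (\<lambda>y. frechet_derivative g (at y) 1)"
        using Suc.prems(1) by simp
      then show "C_diff m S (\<lambda>x. frechet_derivative g (at (f x)) 1)"
        using C_diff_SucD[OF Suc.prems(2)] by (rule Suc.IH)
    qed
  qed
qed

text \<open>The derivative is a polynomial in \<open>inverse\<close> itself, so order
  \<open>m\<close> feeds order \<open>Suc m\<close>.\<close>

lemma C_diff_inverse: "C_diff m (- {0::real}) inverse"
proof (induction m)
  case 0
  then show ?case by (auto intro!: continuous_intros)
next
  case (Suc m)
  show ?case
  proof (rule C_diff_SucI)
    show "(inverse has_derivative (\<lambda>u. (- u * inverse x) *\<^sub>R inverse x)) (at x)"
      if "x \<in> - {0}" for x :: real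
      using that by (auto intro!: derivative_eq_intros)
    have "C_diff m (- {0}) (\<lambda>x::real. - u)" for u by (rule C_diff_const) auto
    then have "C_diff m (- {0}) (\<lambda>x::real. (- u *\<^sub>R inverse x) *\<^sub>R inverse x)" for u
      by (intro C_diff_scaleR Suc) auto
    then show "C_diff m (- {0}) (\<lambda>x::real. (- u * inverse x) *\<^sub>R inverse x)" for u by simp
  qed auto
qed

text \<open>Conditional on the same order for \<open>norm\<close>, because the induction for
  \<open>norm\<close> calls it: the gradient x / |x| of the norm contains this factor.\<close>

lemma C_diff_inverse_norm:
  assumes "C_diff m (- {0}) (norm :: 'a::euclidean_space \<Rightarrow> real)"
  shows "C_diff m (- {0}) (\<lambda>x::'a. inverse (norm x))"
  by (rule C_diff_compose_real[OF _ _ C_diff_inverse assms]) auto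

lemma C_diff_norm: "C_diff m (- {0}) (norm :: 'a::euclidean_space \<Rightarrow> real)"
proof (induction m)
  case 0
  then show ?case by (simp add: continuous_on_norm)
next
  case (Suc m)
  show ?case
  proof (rule C_diff_SucI)
    show "(norm has_derivative (\<lambda>u. inverse (norm x) *\<^sub>R (x \<bullet> u))) (at x)" if "x \<in> - {0}" for x :: 'a
      using that has_derivative_norm[of x]
      by (simp add: sgn_div_norm inner_commute)
    show "C_diff m (- {0}) (\<lambda>x::'a. inverse (norm x) *\<^sub>R (x \<bullet> u))" for u :: 'a
      by (intro C_diff_scaleR C_diff_inverse_norm Suc C_diff_bounded_linear bounded_linear_inner_left) auto
  qed auto
qed

text \<open>Off the origin the map is a product of smooth factors; on the ball of radius
  \<open>\<delta>\<close> it is linear, which avoids the singularity of 1 / |x|. The two open sets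
  cover the space. Both the warping function and its inverse have this form.\<close>

lemma C_diff_radial:
  fixes h q :: "real \<Rightarrow> real"
  assumes "C_diff m UNIV h" "\<And>t. t > 0 \<Longrightarrow> q t = h t / t"
    and "\<delta> > 0" "\<And>t. 0 \<le> t \<Longrightarrow> t < \<delta> \<Longrightarrow> q t = c"
  shows "C_diff m UNIV (\<lambda>x::'a::euclidean_space. q (norm x) *\<^sub>R x)"
proof -
  have "C_diff m (- {0}) (\<lambda>x::'a. h (norm x) *\<^sub>R (inverse (norm x) *\<^sub>R x))"
    by (intro C_diff_scaleR C_diff_inverse_norm C_diff_norm C_diff_compose_real[OF _ _ assms(1)]
        C_diff_bounded_linear bounded_linear_ident) auto
  then have 1: "C_diff m (- {0}) (\<lambda>x::'a. q (norm x) *\<^sub>R x)"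
    by (rule C_diff_cong_open[rotated 2]) (auto simp: assms(2) divide_inverse)
  have "C_diff m (ball 0 \<delta>) (\<lambda>x::'a. c *\<^sub>R x)"
    by (intro C_diff_bounded_linear bounded_linear_scaleR_right) auto
  then have 2: "C_diff m (ball 0 \<delta>) (\<lambda>x::'a. q (norm x) *\<^sub>R x)"
    by (rule C_diff_cong_open[rotated 2]) (auto simp: assms(4))
  have "- {0::'a} \<union> ball 0 \<delta> = UNIV" using \<open>\<delta> > 0\<close> by auto
  with C_diff_Un[OF _ _ 1 2] show ?thesis by (simp add: open_Compl)
qed

lemma C_diff_real_deriv:
  fixes h :: "real \<Rightarrow> real"
  assumes "C_diff (Suc m) UNIV h"
  shows "C_diff m UNIV (deriv h)" and "(h has_real_derivative deriv h x) (at x)"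
proof -
  have "h differentiable (at x)" for x using assms by simp
  then show D: "(h has_real_derivative deriv h x) (at x)" for x
    by (metis DERIV_deriv_iff_real_differentiable)
  have "frechet_derivative h (at x) 1 = deriv h x" for x
    using frechet_derivative_at[OF D[unfolded has_field_derivative_def, of x], symmetric] by simp
  moreover have "C_diff m UNIV (\<lambda>x. frechet_derivative h (at x) 1)"
    using assms by simp
  ultimately show "C_diff m UNIV (deriv h)" by (simp add: ext)
qed

lemma C_diff_real_iterated_deriv:
  fixes h :: "real \<Rightarrow> real"
  assumes "C_diff m UNIV h" "l < m"
  shows "((deriv ^^ l) h has_real_derivative (deriv ^^ Suc l) h x) (at x)"
  using assms
proof (induction m arbitrary: h l)
  case (Suc m)
  show ?case
  proof (cases l)
    case 0
    then show ?thesis using C_diff_real_deriv(2)[OF Suc.prems(1)] by simp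
  next
    case (Suc l')
    show ?thesis
      using Suc.IH[OF C_diff_real_deriv(1)[OF Suc.prems(1)], of l'] Suc Suc.prems(2)
      by (simp add: funpow_swap1)
  qed
qed simp

subsection \<open>Homogeneous functions and their partial derivatives\<close>

text \<open>\<open>decay q F\<close>: \<open>F\<close> is a polynomial in the functions \<open>x\<^sub>i / \<bar>x\<bar>\<close> (degree 0) and
  \<open>1 / \<bar>x\<bar>\<close> (degree 1) all of whose terms have degree at least \<open>q\<close>.\<close>

inductive decay :: "nat \<Rightarrow> (real^'n::finite \<Rightarrow> real) \<Rightarrow> bool" where
  decay_const: "decay 0 (\<lambda>x. a)"
| decay_direction: "decay 0 (\<lambda>x. x $ i / norm x)"
| decay_inverse: "decay (Suc 0) (\<lambda>x. inverse (norm x))"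
| decay_add: "decay q F \<Longrightarrow> decay q G \<Longrightarrow> decay q (\<lambda>x. F x + G x)"
| decay_mult: "decay p F \<Longrightarrow> decay q G \<Longrightarrow> decay (p + q) (\<lambda>x. F x * G x)"
| decay_weaken: "decay (Suc q) F \<Longrightarrow> decay q F"

lemma decay_mult0: "decay 0 F \<Longrightarrow> decay q G \<Longrightarrow> decay q (\<lambda>x. F x * G x)"
  using decay_mult[where p = 0 and q = q and F = F and G = G] by simp

lemma decay_zero: "decay q (\<lambda>x. 0)"
proof (induction q)
  case (Suc q)
  show ?case using decay_mult[OF decay_inverse Suc] by simp
qed (rule decay_const)

lemma decay_prod_list: "decay 0 (\<lambda>x. \<Prod>i\<leftarrow>js. x $ i / norm x)"
proof (induction js)
  case (Cons i js)
  show ?case using decay_mult0[OF decay_direction Cons] by simp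
qed (simp add: decay_const)

lemma norm_has_partial_derivative:
  fixes x :: "real^'n::finite"
  assumes "x \<noteq> 0"
  shows "((\<lambda>t. norm (x + t *\<^sub>R axis s 1)) has_real_derivative x $ s / norm x) (at 0)"
proof -
  have "((\<lambda>t. x + t *\<^sub>R axis s 1) has_derivative (\<lambda>t. t *\<^sub>R axis s 1)) (at 0)"
    by (auto intro!: derivative_eq_intros)
  from has_derivative_compose[OF this, of norm "\<lambda>u. u \<bullet> sgn x"]
  have "((\<lambda>t. norm (x + t *\<^sub>R axis s 1)) has_derivative (\<lambda>t. (t *\<^sub>R axis s 1) \<bullet> sgn x)) (at 0)"
    using has_derivative_norm[OF assms] by simp
  then show ?thesis unfolding has_field_derivative_def
    by (rule has_derivative_eq_rhs) (auto simp: sgn_div_norm inner_axis' divide_inverse mult_ac)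
qed

text \<open>Differentiation raises the degree by one. It suffices to see this on the generators: x_i
  / |x| has the derivative (delta_is - x_i x_s / |x|^2) / |x|, and 1 / |x| has -(x_s / |x|) / |x|^2;
  sums and products follow by the usual rules.\<close>

lemma decay_has_partial_derivative:
  fixes F :: "real^'n::finite \<Rightarrow> real"
  assumes "decay q F"
  shows "\<exists>G. decay (Suc q) G \<and>
    (\<forall>x. x \<noteq> 0 \<longrightarrow> ((\<lambda>t. F (x + t *\<^sub>R axis s 1)) has_real_derivative G x) (at 0))"
  using assms
proof (induction rule: decay.induct)
  case (decay_const a)
  show ?case by (rule exI[of _ "\<lambda>x. 0"]) (auto intro: decay_zero)
next
  case (decay_direction i)
  let ?d = "if i = s then 1 else 0 :: real"
  \<comment> \<open>\<open>?d\<close> is the Kronecker delta. The minus sign is written as a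
    constant factor because the rules of \<open>decay\<close> know only sums and products.\<close>
  let ?G = "\<lambda>x::real^'n. (?d + - 1 * (x $ i / norm x) * (x $ s / norm x)) * inverse (norm x)"
  have "decay (0 + Suc 0) ?G"
    by (intro decay_mult[OF _ decay_inverse] decay_add decay_mult0 decay.intros)
  moreover have "((\<lambda>t. (x + t *\<^sub>R axis s 1) $ i / norm (x + t *\<^sub>R axis s 1)) has_real_derivative ?G x) (at 0)"
    if "x \<noteq> 0" for x :: "real^'n"
  proof -
    have "((\<lambda>t. (x + t *\<^sub>R axis s 1) $ i) has_real_derivative ?d) (at 0)"
      by (auto intro!: derivative_eq_intros simp: axis_def)
    from DERIV_divide[OF this norm_has_partial_derivative[OF that, of s]] that
    have "((\<lambda>t. (x + t *\<^sub>R axis s 1) $ i / norm (x + t *\<^sub>R axis s 1)) has_real_derivative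
        (?d * norm x - x $ i * (x $ s / norm x)) / (norm x * norm x)) (at 0)" by simp
    then show ?thesis
      by (rule DERIV_cong) (use that in \<open>simp add: field_simps split del: if_split\<close>)
  qed
  ultimately show ?case by (intro exI[of _ ?G]) simp
next
  case decay_inverse
  let ?G = "\<lambda>x::real^'n. (- 1 * (x $ s / norm x)) * (inverse (norm x) * inverse (norm x))"
  have "decay (0 + (Suc 0 + Suc 0)) ?G"
    by (intro decay_mult decay_mult0 decay.intros)
  moreover have "((\<lambda>t. inverse (norm (x + t *\<^sub>R axis s 1))) has_real_derivative ?G x) (at 0)"
    if "x \<noteq> 0" for x :: "real^'n"
    using that by (intro DERIV_cong[OF DERIV_inverse_fun[OF norm_has_partial_derivative[OF that, of s]]])
      (auto simp: field_simps)
  ultimately show ?case by (intro exI[of _ ?G]) simp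
next
  case (decay_add q F G)
  then obtain F' G' where "decay (Suc q) F'" "decay (Suc q) G'"
    "\<And>x. x \<noteq> 0 \<Longrightarrow> ((\<lambda>t. F (x + t *\<^sub>R axis s 1)) has_real_derivative F' x) (at 0)"
    "\<And>x. x \<noteq> 0 \<Longrightarrow> ((\<lambda>t. G (x + t *\<^sub>R axis s 1)) has_real_derivative G' x) (at 0)"
    by blast
  then show ?case
    by (intro exI[of _ "\<lambda>x. F' x + G' x"]) (auto intro: decay.decay_add DERIV_add)
next
  case (decay_mult p F q G)
  then obtain F' G' where *: "decay (Suc p) F'" "decay (Suc q) G'"
    "\<And>x. x \<noteq> 0 \<Longrightarrow> ((\<lambda>t. F (x + t *\<^sub>R axis s 1)) has_real_derivative F' x) (at 0)"
    "\<And>x. x \<noteq> 0 \<Longrightarrow> ((\<lambda>t. G (x + t *\<^sub>R axis s 1)) has_real_derivative G' x) (at 0)"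
    by blast
  have "decay (Suc (p + q)) (\<lambda>x. F' x * G x + F x * G' x)"
    using decay.decay_mult[OF *(1) decay_mult.hyps(2)] decay.decay_mult[OF decay_mult.hyps(1) *(2)]
    by (intro decay.decay_add) auto
  moreover have "((\<lambda>t. F (x + t *\<^sub>R axis s 1) * G (x + t *\<^sub>R axis s 1)) has_real_derivative
      F' x * G x + F x * G' x) (at 0)" if "x \<noteq> 0" for x
    using DERIV_mult[OF *(3)[OF that] *(4)[OF that]] by (simp add: mult_ac add.commute)
  ultimately show ?case by (intro exI[of _ "\<lambda>x. F' x * G x + F x * G' x"]) blast
next
  case (decay_weaken q F)
  then show ?case by (blast intro: decay.decay_weaken)
qed

text \<open>Staying outside a ball keeps 1 / |x| below 1 / \<open>\<delta>\<close>; this is what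
  makes the weakening rule harmless, at the cost of a factor 1 / \<open>\<delta>\<close> in the
  constant.\<close>

lemma decay_bound:
  fixes F :: "real^'n::finite \<Rightarrow> real"
  assumes "decay q F" "\<delta> > 0"
  shows "\<exists>C\<ge>0. \<forall>x. norm x \<ge> \<delta> \<longrightarrow> \<bar>F x\<bar> \<le> C * inverse (norm x) ^ q"
  using assms(1)
proof (induction rule: decay.induct)
  case (decay_const a)
  show ?case by (rule exI[of _ "\<bar>a\<bar>"]) simp
next
  case (decay_direction i)
  have "\<bar>x $ i / norm x\<bar> \<le> 1" for x :: "real^'n"
    using component_le_norm_cart[of x i] by (cases "x = 0") (auto simp: field_simps)
  then show ?case by (intro exI[of _ 1]) simp
next
  case decay_inverse
  show ?case by (rule exI[of _ 1]) simp
next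
  case (decay_add q F G)
  then obtain C D where "C \<ge> 0" "D \<ge> 0"
    "\<And>x. norm x \<ge> \<delta> \<Longrightarrow> \<bar>F x\<bar> \<le> C * inverse (norm x) ^ q"
    "\<And>x. norm x \<ge> \<delta> \<Longrightarrow> \<bar>G x\<bar> \<le> D * inverse (norm x) ^ q" by blast
  then show ?case
    by (intro exI[of _ "C + D"]) (fastforce simp: distrib_right intro: order_trans[OF abs_triangle_ineq add_mono])
next
  case (decay_mult p F q G)
  then obtain C D where *: "C \<ge> 0" "D \<ge> 0"
    "\<And>x. norm x \<ge> \<delta> \<Longrightarrow> \<bar>F x\<bar> \<le> C * inverse (norm x) ^ p"
    "\<And>x. norm x \<ge> \<delta> \<Longrightarrow> \<bar>G x\<bar> \<le> D * inverse (norm x) ^ q" by blast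
  have "\<bar>F x * G x\<bar> \<le> (C * D) * inverse (norm x) ^ (p + q)" if "norm x \<ge> \<delta>" for x
    using mult_mono[OF *(3)[OF that] *(4)[OF that]] *(1) by (simp add: abs_mult power_add mult_ac)
  then show ?case using * by (intro exI[of _ "C * D"]) auto
next
  case (decay_weaken q F)
  then obtain C where *: "C \<ge> 0"
    "\<And>x. norm x \<ge> \<delta> \<Longrightarrow> \<bar>F x\<bar> \<le> C * inverse (norm x) ^ Suc q" by blast
  have "\<bar>F x\<bar> \<le> (C / \<delta>) * inverse (norm x) ^ q" if "norm x \<ge> \<delta>" for x
  proof -
    have "inverse (norm x) \<le> inverse \<delta>" using that \<open>\<delta> > 0\<close> by (simp add: le_imp_inverse_le)
    then have "C * (inverse (norm x) * inverse (norm x) ^ q) \<le> C * (inverse \<delta> * inverse (norm x) ^ q)"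
      using *(1) by (intro mult_left_mono mult_right_mono) auto
    then show ?thesis using *(2)[OF that] by (simp add: divide_inverse mult_ac)
  qed
  then show ?case using * \<open>\<delta> > 0\<close> by (intro exI[of _ "C / \<delta>"]) auto
qed

subsection \<open>Matrices with a radial and a tangential eigenvalue\<close>

lemma has_vector_derivative_cart_componentwise:
  fixes f :: "real \<Rightarrow> 'b::euclidean_space^'n::finite"
  shows "(f has_vector_derivative D) (at t) \<longleftrightarrow>
    (\<forall>i. ((\<lambda>s. f s $ i) has_vector_derivative D $ i) (at t))"
proof
  assume "(f has_vector_derivative D) (at t)"
  then show "\<forall>i. ((\<lambda>s. f s $ i) has_vector_derivative D $ i) (at t)"
    by (auto intro: bounded_linear.has_vector_derivative[OF bounded_linear_vec_nth])
next
  assume *: "\<forall>i. ((\<lambda>s. f s $ i) has_vector_derivative D $ i) (at t)"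
  have "((\<lambda>s. f s \<bullet> axis i b) has_derivative (\<lambda>s. (s *\<^sub>R D) \<bullet> axis i b)) (at t)" for i b
    using bounded_linear.has_vector_derivative[OF bounded_linear_inner_left *[rule_format], of i b]
    by (simp add: inner_axis has_vector_derivative_def)
  then show "(f has_vector_derivative D) (at t)"
    unfolding has_vector_derivative_def
    by (subst has_derivative_componentwise_within) (auto simp: Basis_vec_def)
qed

lemma has_vector_derivative_matrix_componentwise:
  fixes f :: "real \<Rightarrow> real^'n::finite^'m::finite"
  assumes "\<And>i j. ((\<lambda>s. f s $ i $ j) has_real_derivative D $ i $ j) (at t)"
  shows "(f has_vector_derivative D) (at t)"
  using assms
  by (simp add: has_vector_derivative_cart_componentwise has_real_derivative_iff_has_vector_derivative)

text \<open>For nonzero \<open>x\<close> this is the symmetric matrix with eigenvalue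
  \<open>b\<close> on the line through \<open>x\<close> and \<open>a\<close> on the orthogonal
  complement. At the origin division by zero removes the second term, leaving \<open>a\<close> times
  the identity.\<close>

definition radial_matrix :: "real \<Rightarrow> real \<Rightarrow> real^'n::finite \<Rightarrow> real^'n^'n" where
  "radial_matrix a b x = (\<chi> i j. (if i = j then a else 0) + (b - a) * (x $ i / norm x * (x $ j / norm x)))"

lemma radial_matrix_vector_mult:
  "radial_matrix a b x *v y = a *\<^sub>R y + ((b - a) * (sgn x \<bullet> y)) *\<^sub>R sgn x"
proof (simp add: vec_eq_iff, intro allI)
  fix i
  have "(radial_matrix a b x *v y) $ i =
      (\<Sum>j\<in>UNIV. (if i = j then a * y $ j else 0) + (b - a) * sgn x $ i * (sgn x $ j * y $ j))"
    by (auto simp: matrix_vector_mult_def radial_matrix_def sgn_div_norm divide_inverse algebra_simps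
      intro!: sum.cong)
  also have "\<dots> = a * y $ i + (b - a) * sgn x $ i * (sgn x \<bullet> y)"
    by (simp add: sum.distrib inner_vec_def sum_distrib_left)
  finally show "(radial_matrix a b x *v y) $ i = a * y $ i + (b - a) * (sgn x \<bullet> y) * sgn x $ i"
    by simp
qed

lemma transpose_radial_matrix [simp]: "transpose (radial_matrix a b x) = radial_matrix a b x"
  by (auto simp: radial_matrix_def transpose_def vec_eq_iff)

text \<open>Matrices with the same \<open>x\<close> are simultaneously diagonalisable, so
  eigenvalues multiply.\<close>

lemma radial_matrix_mult:
  "radial_matrix a b x ** radial_matrix a' b' x = radial_matrix (a * a') (b * b') x"
proof -
  have "sgn x \<bullet> sgn x = (if x = 0 then 0 else 1)"
    by (simp add: dot_square_norm norm_sgn)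
  then show ?thesis
    by (auto simp: matrix_eq radial_matrix_vector_mult matrix_vector_mul_assoc[symmetric] inner_add_right
        algebra_simps simp flip: scaleR_add_left)
qed

lemma radial_matrix_one [simp]: "radial_matrix 1 1 x = mat 1"
  by (simp add: matrix_eq radial_matrix_vector_mult)

text \<open>An orthogonal \<open>Q\<close> taking a coordinate axis to the direction of
  \<open>x\<close> conjugates the matrix to a diagonal one with a single entry \<open>b\<close>. At
  the origin the matrix ignores \<open>b\<close>, whence the condition \<open>b = a\<close>; any
  axis then serves as \<open>e\<close>.\<close>

lemma det_radial_matrix:
  fixes x :: "real^'n::finite"
  assumes "x \<noteq> 0 \<or> b = a"
  shows "det (radial_matrix a b x) = b * a ^ (CARD('n) - 1)"
proof -
  obtain k :: 'n where True by simp
  define e :: "real^'n" where "e = (if x = 0 then axis k 1 else sgn x)"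
  have "norm e = 1" by (simp add: e_def norm_sgn)
  then obtain Q where Q: "orthogonal_matrix Q" "Q *v axis k 1 = e"
    by (metis orthogonal_matrix_exists_basis)
  have orth: "(Q *v y) \<bullet> (Q *v z) = y \<bullet> z" for y z
  proof -
    have "orthogonal_transformation ((*v) Q)" using Q(1) by (simp add: orthogonal_transformation_matrix)
    then show ?thesis by (simp add: orthogonal_transformation_def)
  qed
  have "radial_matrix a b x ** Q = Q ** radial_matrix a b (axis k 1)"
  proof -
    have "radial_matrix a b x *v (Q *v y) = Q *v (radial_matrix a b (axis k 1) *v y)" for y
    proof -
      have "(b - a) * (sgn x \<bullet> (Q *v y)) = (b - a) * (axis k 1 \<bullet> y)" if "x \<noteq> 0"
        using orth[of "axis k 1" y] Q(2) that by (simp add: e_def)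
      moreover have "sgn (axis k (1::real)) = axis k 1" by (simp add: sgn_div_norm)
      ultimately show ?thesis using assms Q(2)
        by (cases "x = 0") (auto simp: radial_matrix_vector_mult e_def matrix_vector_right_distrib
          matrix_vector_mult_scaleR)
    qed
    then show ?thesis by (simp add: matrix_eq matrix_vector_mul_assoc[symmetric])
  qed
  then have "det (radial_matrix a b x) * det Q = det Q * det (radial_matrix a b (axis k 1))"
    by (metis det_mul)
  moreover have "det Q \<noteq> 0" using det_orthogonal_matrix[OF Q(1)] by auto
  ultimately have "det (radial_matrix a b x) = det (radial_matrix a b (axis k 1 :: real^'n))" by simp
  also have "\<dots> = (\<Prod>i\<in>UNIV. radial_matrix a b (axis k 1) $ i $ i)"
    by (rule det_diagonal) (auto simp: radial_matrix_def axis_def)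
  also have "\<dots> = (\<Prod>i\<in>UNIV. if i = k then b else a)"
    by (intro prod.cong) (auto simp: radial_matrix_def axis_def norm_axis_1[unfolded axis_def])
  also have "\<dots> = b * a ^ (CARD('n) - 1)"
    by (simp add: prod.remove[of UNIV k] card_Diff_singleton)
  finally show ?thesis .
qed

lemma matrix_inv_eqI:
  fixes A B :: "real^'n::finite^'n"
  assumes "A ** B = mat 1"
  shows "matrix_inv A = B"
proof -
  have BA: "B ** A = mat 1" using assms by (simp add: matrix_left_right_inverse)
  show ?thesis unfolding matrix_inv_def
  proof (rule some_equality)
    show "A ** B = mat 1 \<and> B ** A = mat 1" using assms BA by simp
    show "C = B" if "A ** C = mat 1 \<and> C ** A = mat 1" for C
    proof -
      have "C = (B ** A) ** C" by (simp add: BA)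
      also have "\<dots> = B" using that by (simp flip: matrix_mul_assoc)
      finally show ?thesis .
    qed
  qed
qed

subsection \<open>Multi-indices and radial weights\<close>

lemma norm_scaleR_sgn: "norm x *\<^sub>R sgn x = (x :: 'a::real_normed_vector)"
  by (cases "x = 0") (simp_all add: sgn_div_norm)

lemma ex_list_count_list:
  fixes \<alpha> :: "'n::finite \<Rightarrow> nat"
  shows "\<exists>js. \<forall>i. count_list js i = \<alpha> i"
proof -
  obtain js where "mset js = (\<Sum>i\<in>UNIV. replicate_mset (\<alpha> i) i)"
    using ex_mset by blast
  then have "count (mset js) i = (\<Sum>j\<in>UNIV. if i = j then \<alpha> j else 0)" for i
    by (simp add: count_sum)
  then have "\<forall>i. count_list js i = \<alpha> i" by (simp add: count_mset)
  then show ?thesis ..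
qed

text \<open>Later bounds hold for every coordinate list of length at most \<open>k\<close>, so only
  the length of the list chosen in \<open>multi_deriv\<close> matters.\<close>

lemma multi_deriv_eq_foldr:
  fixes \<alpha> :: "'n::finite \<Rightarrow> nat"
  obtains js where "length js = (\<Sum>i\<in>UNIV. \<alpha> i)" "multi_deriv \<alpha> f = foldr partial_deriv js f"
proof -
  define js where "js = (SOME js. \<forall>i. count_list js i = \<alpha> i)"
  have "\<forall>i. count_list js i = \<alpha> i"
    unfolding js_def by (rule someI_ex) (rule ex_list_count_list)
  then have "length js = (\<Sum>i\<in>UNIV. \<alpha> i)"
    using sum_count_set[of js UNIV] by simp
  then show thesis using that by (simp add: multi_deriv_def js_def)
qed

text \<open>The factor 1 + |\<tau>| is submultiplicative, and so is \<open>v\<close> of the norm by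
  monotonicity and the triangle inequality. The constant is absorbed since \<open>C \<ge> 1\<close>
  gives \<open>C \<le> C * C\<close>.\<close>

lemma control_weight_radial:
  fixes v :: "real \<Rightarrow> real"
  assumes v: "control_weight v" and C: "C \<ge> 1"
  shows "control_weight (\<lambda>\<tau>::real^'n::finite. C * (1 + norm \<tau>) * v (norm \<tau>))"
proof -
  have pos: "v x > 0" for x using v by (simp add: control_weight_def weight_def)
  have mono: "v x \<le> v y" if "\<bar>x\<bar> \<le> \<bar>y\<bar>" for x y
    using v that by (simp add: control_weight_def radially_increasing_def)
  have "continuous_on UNIV (\<lambda>\<tau>::real^'n. v (norm \<tau>))"
    using v by (intro continuous_on_compose2[of UNIV v UNIV norm] continuous_intros)
      (auto simp: control_weight_def)
  then have cont: "continuous_on UNIV (\<lambda>\<tau>::real^'n. C * (1 + norm \<tau>) * v (norm \<tau>))"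
    by (intro continuous_intros)
  have "C * (1 + norm (\<sigma> + \<tau>)) * v (norm (\<sigma> + \<tau>)) \<le>
      (C * (1 + norm \<sigma>) * v (norm \<sigma>)) * (C * (1 + norm \<tau>) * v (norm \<tau>))" for \<sigma> \<tau> :: "real^'n"
  proof -
    have 1: "1 + norm (\<sigma> + \<tau>) \<le> (1 + norm \<sigma>) * (1 + norm \<tau>)"
      using norm_triangle_ineq[of \<sigma> \<tau>] mult_nonneg_nonneg[of "norm \<sigma>" "norm \<tau>"]
      by (simp add: algebra_simps del: mult_nonneg_nonneg)
    have "v (norm (\<sigma> + \<tau>)) \<le> v (norm \<sigma> + norm \<tau>)"
      using norm_triangle_ineq[of \<sigma> \<tau>] by (intro mono) auto
    also have "\<dots> \<le> v (norm \<sigma>) * v (norm \<tau>)"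
      using v by (simp add: control_weight_def submultiplicative_def)
    finally have 2: "v (norm (\<sigma> + \<tau>)) \<le> v (norm \<sigma>) * v (norm \<tau>)" .
    have "C * 1 \<le> C * C" using C by (intro mult_left_mono) auto
    then have "C * (1 + norm (\<sigma> + \<tau>)) * v (norm (\<sigma> + \<tau>)) \<le>
      (C * C) * ((1 + norm \<sigma>) * (1 + norm \<tau>)) * (v (norm \<sigma>) * v (norm \<tau>))"
      using 1 2 C pos by (intro mult_mono) (auto intro: less_imp_le)
    then show ?thesis by (simp add: mult_ac)
  qed
  moreover have "C * (1 + norm \<sigma>) * v (norm \<sigma>) \<le> C * (1 + norm \<tau>) * v (norm \<tau>)"
    if "norm \<sigma> \<le> norm \<tau>" for \<sigma> \<tau> :: "real^'n"
    using that C pos mono[of "norm \<sigma>" "norm \<tau>"] by (intro mult_mono) (auto intro: less_imp_le)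
  moreover have "C * (1 + norm \<tau>) * v (norm \<tau>) > 0" for \<tau> :: "real^'n"
    using C pos by (intro mult_pos_pos) (auto simp: add_pos_nonneg)
  ultimately show ?thesis using cont
    by (auto simp: control_weight_def weight_def submultiplicative_def radially_increasing_def
      intro: borel_measurable_continuous_onI)
qed

subsection \<open>Radial profiles\<close>

text \<open>Everything is stated for the inverse \<open>h\<close> of the radial component and the
  quotient \<open>g\<close>. Hence \<open>c\<close> is the slope of \<open>h\<close> at the origin,
  the reciprocal of the slope of \<open>\<rho>\<close>.\<close>

locale radial_profile =
  fixes h g v :: "real \<Rightarrow> real" and k :: nat and \<delta> c C0 C1 :: real
  assumes smooth: "C_diff (Suc k) UNIV h"
    and \<delta>_pos: "\<delta> > 0" and c_pos: "c > 0"
    and h_linear: "\<And>x. \<bar>x\<bar> < \<delta> \<Longrightarrow> h x = c * x"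
    and g_0: "g 0 = c" and g_eq: "\<And>x. x \<noteq> 0 \<Longrightarrow> g x = h x / x"
    and g_pos: "\<And>x. g x > 0" and h'_pos: "\<And>x. deriv h x > 0"
    and control: "control_weight v"
    and g_moderate: "\<And>x y. g (x + y) \<le> v x * g y"
    and C0_pos: "C0 > 0" and h'_ge: "\<And>x. x > 0 \<Longrightarrow> C0 * g x \<le> deriv h x"
    and C1_pos: "C1 > 0" and h'_le: "\<And>x. x > 0 \<Longrightarrow> deriv h x \<le> C1 * (1 + x) * g x"
    and h_deriv_le: "\<And>x y l. 0 \<le> x \<Longrightarrow> 0 \<le> y \<Longrightarrow> 1 \<le> l \<Longrightarrow> l \<le> Suc k \<Longrightarrow>
      \<bar>(deriv ^^ l) h x\<bar> \<le> v (x - y) * deriv h y"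
begin

section \<open>Elementary properties of the profile\<close>

lemma h_has_deriv: "l \<le> k \<Longrightarrow> ((deriv ^^ l) h has_real_derivative (deriv ^^ Suc l) h x) (at x)"
  using C_diff_real_iterated_deriv[OF smooth] by (simp add: less_Suc_eq_le)

lemma g_linear:
  assumes "\<bar>x\<bar> < \<delta>"
  shows "g x = c"
  using h_linear[OF assms] by (cases "x = 0") (simp_all add: g_0 g_eq)

lemma h'_linear:
  assumes "\<bar>x\<bar> < \<delta>"
  shows "deriv h x = c"
proof (rule DERIV_imp_deriv)
  have "((\<lambda>x. c * x) has_real_derivative c) (at x)" by (auto intro!: derivative_eq_intros)
  moreover have "x \<in> {-\<delta><..<\<delta>}" using assms by auto
  ultimately show "(h has_real_derivative c) (at x)"
    by (rule has_field_derivative_transform_within_open[OF _ open_greaterThanLessThan]) (auto simp: h_linear)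
qed

lemma v_mono: "\<bar>x\<bar> \<le> \<bar>y\<bar> \<Longrightarrow> v x \<le> v y"
  using control by (simp add: control_weight_def radially_increasing_def)

lemma v_ge_1: "v x \<ge> 1"
proof -
  have "0 < v 0" "v (0 + 0) \<le> v 0 * v 0"
    using control unfolding control_weight_def submultiplicative_def weight_def by blast+
  then have "1 \<le> v 0" by simp
  also have "v 0 \<le> v x" by (rule v_mono) simp
  finally show ?thesis .
qed

text \<open>Extends the two comparisons to the origin. Near it both \<open>deriv h\<close> and
  \<open>g\<close> equal \<open>c\<close>, so the lower bound can be read off at
  \<open>\<delta> / 2\<close> and the upper one follows by letting x tend to 0.\<close>

lemma h'_ge': "x \<ge> 0 \<Longrightarrow> C0 * g x \<le> deriv h x"
  and h'_le': "x \<ge> 0 \<Longrightarrow> deriv h x \<le> C1 * (1 + x) * g x"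
proof -
  have "C0 * c \<le> c"
    using h'_ge[of "\<delta> / 2"] h'_linear[of "\<delta> / 2"] g_linear[of "\<delta> / 2"] \<delta>_pos by simp
  moreover have "c \<le> C1 * c"
  proof (rule field_le_epsilon)
    fix e :: real assume "e > 0"
    \<comment> \<open>Small enough for the linear regime and for the error \<open>C1 * c * x\<close>
      to be at most \<open>e\<close>.\<close>
    define x where "x = min (\<delta> / 2) (e / (C1 * c))"
    have x: "0 < x" "\<bar>x\<bar> < \<delta>" using \<delta>_pos \<open>e > 0\<close> C1_pos c_pos by (auto simp: x_def)
    have "x \<le> e / (C1 * c)" by (simp add: x_def)
    then have "C1 * c * x \<le> e" using C1_pos c_pos by (simp add: field_simps)
    moreover have "c \<le> C1 * (1 + x) * c" using h'_le[OF x(1)] x(2) by (simp add: h'_linear g_linear)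
    ultimately show "c \<le> C1 * c + e" by (simp add: algebra_simps)
  qed
  ultimately show "x \<ge> 0 \<Longrightarrow> C0 * g x \<le> deriv h x" "x \<ge> 0 \<Longrightarrow> deriv h x \<le> C1 * (1 + x) * g x"
    using h'_ge[of x] h'_le[of x] h'_linear[of 0] \<delta>_pos g_0 by (cases "x = 0"; simp)+
qed

section \<open>The inverse warping function and its Jacobian\<close>

definition \<Psi> :: "real^'n::finite \<Rightarrow> real^'n" where "\<Psi> x = g (norm x) *\<^sub>R x"

definition A :: "real^'n::finite \<Rightarrow> real^'n^'n" where
  "A x = radial_matrix (g (norm x)) (deriv h (norm x)) x"

text \<open>Since \<open>A x\<close> is symmetric, its inverse \<open>B x\<close> is also the
  inverse transpose that enters \<open>warping_phi\<close>.\<close>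

definition B :: "real^'n::finite \<Rightarrow> real^'n^'n" where
  "B x = radial_matrix (inverse (g (norm x))) (inverse (deriv h (norm x))) x"

lemma A_linear: "norm x < \<delta> \<Longrightarrow> A x = mat c"
  by (auto simp: A_def radial_matrix_def g_linear h'_linear mat_def vec_eq_iff)

lemma A_mult_B: "A x ** B x = mat 1"
proof -
  have "g (norm x) \<noteq> 0" "deriv h (norm x) \<noteq> 0"
    using g_pos[of "norm x"] h'_pos[of "norm x"] by auto
  then show ?thesis by (simp add: A_def B_def radial_matrix_mult)
qed

lemma \<Psi>_C_diff: "C_diff (Suc k) UNIV (\<Psi> :: real^'n::finite \<Rightarrow> real^'n)"
proof -
  have "C_diff (Suc k) UNIV (\<lambda>x::real^'n. g (norm x) *\<^sub>R x)"
    by (rule C_diff_radial[OF smooth _ \<delta>_pos, where c = c]) (auto simp: g_eq g_linear)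
  then show ?thesis by (simp add: \<Psi>_def[abs_def])
qed

text \<open>At the origin, where \<open>norm\<close> is not differentiable, \<open>\<Psi>\<close> is
  locally linear. Elsewhere the quotient and product rules apply, and the terms along
  \<open>sgn x\<close> form the rank-one part of \<open>A x\<close>.\<close>

lemma \<Psi>_has_derivative: "(\<Psi> has_derivative (*v) (A x)) (at x)"
proof (cases "x = 0")
  case True
  have "((*\<^sub>R) c has_derivative (*\<^sub>R) c) (at x)"
    by (intro bounded_linear_imp_has_derivative bounded_linear_scaleR_right)
  then have "(\<Psi> has_derivative (*\<^sub>R) c) (at x)"
    by (rule has_derivative_transform_within_open[where s = "ball 0 \<delta>"])
      (use True \<delta>_pos in \<open>auto simp: \<Psi>_def g_linear\<close>)
  moreover have "(*v) (A x) = (*\<^sub>R) c"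
    using True \<delta>_pos by (auto simp: A_def radial_matrix_vector_mult g_0)
  ultimately show ?thesis by simp
next
  case False
  let ?r = "norm x"
  have h: "(h has_derivative (\<lambda>t. deriv h ?r * t)) (at ?r)"
    using h_has_deriv[of 0 ?r] by (simp add: has_field_derivative_def)
  have "((\<lambda>y. h (norm y) / norm y) has_derivative
      (\<lambda>u. (deriv h ?r * (u \<bullet> sgn x) * ?r - h ?r * (u \<bullet> sgn x)) / (?r * ?r))) (at x)"
    using False by (intro has_derivative_divide' has_derivative_compose[OF has_derivative_norm h]
      has_derivative_norm) auto
  then have "((\<lambda>y. (h (norm y) / norm y) *\<^sub>R y) has_derivative
      (\<lambda>u. (h ?r / ?r) *\<^sub>R u + ((deriv h ?r * (u \<bullet> sgn x) * ?r - h ?r * (u \<bullet> sgn x)) / (?r * ?r)) *\<^sub>R x)) (at x)"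
    by (rule has_derivative_scaleR[OF _ has_derivative_ident])
  then have "(\<Psi> has_derivative
      (\<lambda>u. (h ?r / ?r) *\<^sub>R u + ((deriv h ?r * (u \<bullet> sgn x) * ?r - h ?r * (u \<bullet> sgn x)) / (?r * ?r)) *\<^sub>R x)) (at x)"
    by (rule has_derivative_transform_within_open[where s = "- {0}"])
      (use False in \<open>auto simp: \<Psi>_def g_eq\<close>)
  moreover have "(h ?r / ?r) *\<^sub>R u + ((deriv h ?r * (u \<bullet> sgn x) * ?r - h ?r * (u \<bullet> sgn x)) / (?r * ?r)) *\<^sub>R x
      = A x *v u" for u
  proof -
    have "((deriv h ?r * (u \<bullet> sgn x) * ?r - h ?r * (u \<bullet> sgn x)) / (?r * ?r)) *\<^sub>R x
        = ((deriv h ?r * (u \<bullet> sgn x) * ?r - h ?r * (u \<bullet> sgn x)) / ?r) *\<^sub>R sgn x"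
      by (simp add: sgn_div_norm divide_inverse mult_ac)
    also have "(deriv h ?r * (u \<bullet> sgn x) * ?r - h ?r * (u \<bullet> sgn x)) / ?r
        = (deriv h ?r - g ?r) * (sgn x \<bullet> u)"
      using False by (simp add: g_eq inner_commute field_simps)
    finally show ?thesis using False by (simp add: A_def radial_matrix_vector_mult g_eq)
  qed
  ultimately show ?thesis by (simp add: has_derivative_eq_rhs[OF _ ext])
qed

section \<open>Partial derivatives of the Jacobian\<close>

text \<open>The shape of an \<open>n\<close>-th order partial derivative of \<open>A\<close>, taken along the coordinates \<open>js\<close>. Its
  point is that the top order derivative of \<open>h\<close> occurs only with the projection onto the line
  through \<open>x\<close>.\<close>

definition partials_form ::
  "nat \<Rightarrow> 'n list \<Rightarrow> (real^'n::finite \<Rightarrow> real^'n^'n) \<Rightarrow> bool" where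
  "partials_form n js G \<longleftrightarrow>
     (\<exists>K. (\<forall>i j l. decay (Suc 0) (K i j l)) \<and>
       (\<forall>x i j. x \<noteq> 0 \<longrightarrow> G x $ i $ j =
          (deriv ^^ Suc n) h (norm x) * ((\<Prod>s\<leftarrow>js. x $ s / norm x) * (x $ i / norm x * (x $ j / norm x))) +
          (\<Sum>l\<le>n. (deriv ^^ l) h (norm x) * K i j l x))) \<and>
     (\<forall>x. norm x < \<delta> \<longrightarrow> G x = (if n = 0 then mat c else 0))"

text \<open>Off the origin \<open>g\<close> is h(r) / r, so the tangential part of \<open>A\<close>
  is the summand \<open>l = 0\<close>: the function \<open>h\<close> itself times a factor
  \<open>K\<close> containing 1 / r.\<close>

lemma partials_form_A: "partials_form 0 [] (A :: real^'n::finite \<Rightarrow> real^'n^'n)"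
proof -
  define K :: "'n \<Rightarrow> 'n \<Rightarrow> nat \<Rightarrow> real^'n \<Rightarrow> real" where
    "K i j l x = ((if i = j then 1 else 0) + - 1 * (x $ i / norm x * (x $ j / norm x))) * inverse (norm x)"
    for i j l x
  show ?thesis unfolding partials_form_def
  proof (intro conjI exI[of _ K] allI impI)
    show "decay (Suc 0) (K i j l)" for i j l
      unfolding K_def[abs_def]
      by (intro decay_mult0 decay_inverse decay_add decay_direction decay_const)
    show "A x $ i $ j = (deriv ^^ Suc 0) h (norm x) * ((\<Prod>s\<leftarrow>[]. x $ s / norm x) *
        (x $ i / norm x * (x $ j / norm x))) + (\<Sum>l\<le>0. (deriv ^^ l) h (norm x) * K i j l x)"
      if "x \<noteq> 0" for x i j
      using that by (simp add: A_def radial_matrix_def K_def g_eq algebra_simps divide_inverse)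
  qed (simp add: A_linear)
qed

lemma h_norm_has_partial_derivative:
  assumes "x \<noteq> 0" "l \<le> k"
  shows "((\<lambda>t. (deriv ^^ l) h (norm (x + t *\<^sub>R axis s 1))) has_real_derivative
    (deriv ^^ Suc l) h (norm x) * (x $ s / norm x)) (at 0)"
  using DERIV_chain2[OF _ norm_has_partial_derivative[OF assms(1)], of "(deriv ^^ l) h"] h_has_deriv[OF assms(2)]
  by simp

text \<open>By the product rule, only differentiating the top order derivative of \<open>h\<close>
  keeps degree 0; it adds the direction factor for \<open>s\<close>. Differentiating its cofactor
  gains a power of 1 / |x|, so that term joins the sum of lower order. The condition
  \<open>n < k\<close> leaves one more derivative of \<open>h\<close> available.\<close>

lemma partials_form_step:
  fixes G :: "real^'n::finite \<Rightarrow> real^'n^'n"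
  assumes G: "partials_form n js G" and n: "n < k"
  shows "((\<lambda>t. G (x + t *\<^sub>R axis s 1)) has_vector_derivative partial_deriv s G x) (at 0)"
    and "partials_form (Suc n) (s # js) (partial_deriv s G)"
proof -
  let ?M = "\<lambda>i j x. (\<Prod>s\<leftarrow>js. x $ s / norm x) * (x $ i / norm x * (x $ j / norm x))"
  obtain K where K: "\<And>i j l. decay (Suc 0) (K i j l)"
    and G_eq: "\<And>x i j. x \<noteq> 0 \<Longrightarrow> G x $ i $ j =
          (deriv ^^ Suc n) h (norm x) * ?M i j x + (\<Sum>l\<le>n. (deriv ^^ l) h (norm x) * K i j l x)"
    and G_near: "\<And>x. norm x < \<delta> \<Longrightarrow> G x = (if n = 0 then mat c else 0)"
    using G unfolding partials_form_def by blast
  \<comment> \<open>The derivative of \<open>K\<close> even has degree 2; it is weakened to the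
    degree 1 recorded by \<open>partials_form\<close>.\<close>
  have "\<forall>i j l. \<exists>K'. decay (Suc 0) K' \<and> (\<forall>x. x \<noteq> 0 \<longrightarrow>
    ((\<lambda>t. K i j l (x + t *\<^sub>R axis s 1)) has_real_derivative K' x) (at 0))"
    using decay_has_partial_derivative[OF K] by (blast intro: decay_weaken)
  then obtain K' where "\<forall>i j l. decay (Suc 0) (K' i j l) \<and> (\<forall>x. x \<noteq> 0 \<longrightarrow>
    ((\<lambda>t. K i j l (x + t *\<^sub>R axis s 1)) has_real_derivative K' i j l x) (at 0))"
    unfolding choice_iff by (elim exE)
  then have K': "\<And>i j l. decay (Suc 0) (K' i j l)"
    "\<And>i j l x. x \<noteq> 0 \<Longrightarrow> ((\<lambda>t. K i j l (x + t *\<^sub>R axis s 1)) has_real_derivative K' i j l x) (at 0)"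
    by blast+
  have "decay 0 (?M i j)" for i j
    by (intro decay_mult0 decay_prod_list decay_direction)
  then have "\<forall>i j. \<exists>M'. decay (Suc 0) M' \<and> (\<forall>x. x \<noteq> 0 \<longrightarrow>
    ((\<lambda>t. ?M i j (x + t *\<^sub>R axis s 1)) has_real_derivative M' x) (at 0))"
    using decay_has_partial_derivative[of 0 "?M i j" s for i j] by blast
  then obtain M' where "\<forall>i j. decay (Suc 0) (M' i j) \<and> (\<forall>x. x \<noteq> 0 \<longrightarrow>
    ((\<lambda>t. ?M i j (x + t *\<^sub>R axis s 1)) has_real_derivative M' i j x) (at 0))"
    unfolding choice_iff by (elim exE)
  then have M': "\<And>i j. decay (Suc 0) (M' i j)"
    "\<And>i j x. x \<noteq> 0 \<Longrightarrow> ((\<lambda>t. ?M i j (x + t *\<^sub>R axis s 1)) has_real_derivative M' i j x) (at 0)"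
    by blast+
  \<comment> \<open>The coefficient of the \<open>l\<close>-th derivative of \<open>h\<close>. The
    \<open>case\<close> term comes from differentiating derivative number \<open>l - 1\<close>;
    \<open>K'\<close> comes from differentiating the old coefficient, and at
    \<open>l = Suc n\<close> its place is taken by \<open>M'\<close>, from the old leading
    term.\<close>
  define L where "L i j l x = (case l of 0 \<Rightarrow> 0 | Suc l' \<Rightarrow> x $ s / norm x * K i j l' x) +
      (if l \<le> n then K' i j l x else M' i j x)" for i j l x
  have L: "decay (Suc 0) (L i j l)" for i j l
    unfolding L_def[abs_def]
  proof (rule decay_add)
    show "decay (Suc 0) (\<lambda>x. case l of 0 \<Rightarrow> 0 | Suc l' \<Rightarrow> x $ s / norm x * K i j l' x)"
    proof (cases l)
      case (Suc m)
      have "decay (Suc 0) (\<lambda>x. x $ s / norm x * K i j m x)"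
        by (rule decay_mult0[OF decay_direction K])
      then show ?thesis by (simp only: Suc nat.case)
    qed (simp add: decay_zero)
    show "decay (Suc 0) (\<lambda>x. if l \<le> n then K' i j l x else M' i j x)"
      by (cases "l \<le> n") (simp_all only: if_True if_False K'(1) M'(1))
  qed
  define D where "D x = (\<chi> i j. (deriv ^^ Suc (Suc n)) h (norm x) * (x $ s / norm x * ?M i j x) +
      (\<Sum>l\<le>Suc n. (deriv ^^ l) h (norm x) * L i j l x))" for x
  have far: "((\<lambda>t. G (x + t *\<^sub>R axis s 1)) has_vector_derivative D x) (at 0)" if x: "x \<noteq> 0" for x
  proof (rule has_vector_derivative_matrix_componentwise)
    fix i j
    let ?S = "(deriv ^^ Suc (Suc n)) h (norm x) * (x $ s / norm x) * ?M i j x +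
        M' i j x * (deriv ^^ Suc n) h (norm x) +
        (\<Sum>l\<le>n. (deriv ^^ Suc l) h (norm x) * (x $ s / norm x) * K i j l x + K' i j l x * (deriv ^^ l) h (norm x))"
    have "((\<lambda>t. (deriv ^^ Suc n) h (norm (x + t *\<^sub>R axis s 1)) * ?M i j (x + t *\<^sub>R axis s 1) +
        (\<Sum>l\<le>n. (deriv ^^ l) h (norm (x + t *\<^sub>R axis s 1)) * K i j l (x + t *\<^sub>R axis s 1)))
        has_real_derivative ?S) (at 0)"
    proof (intro DERIV_add DERIV_sum)
      show "((\<lambda>t. (deriv ^^ Suc n) h (norm (x + t *\<^sub>R axis s 1)) * ?M i j (x + t *\<^sub>R axis s 1))
          has_real_derivative (deriv ^^ Suc (Suc n)) h (norm x) * (x $ s / norm x) * ?M i j x +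
          M' i j x * (deriv ^^ Suc n) h (norm x)) (at 0)"
        using DERIV_mult[OF h_norm_has_partial_derivative[OF x, of "Suc n" s] M'(2)[OF x, of i j]] n
        by simp
      show "((\<lambda>t. (deriv ^^ l) h (norm (x + t *\<^sub>R axis s 1)) * K i j l (x + t *\<^sub>R axis s 1))
          has_real_derivative (deriv ^^ Suc l) h (norm x) * (x $ s / norm x) * K i j l x +
          K' i j l x * (deriv ^^ l) h (norm x)) (at 0)" if "l \<in> {..n}" for l
        using DERIV_mult[OF h_norm_has_partial_derivative[OF x, of l s] K'(2)[OF x, of i j l]] n that
        by simp
    qed
    moreover have "?S = D x $ i $ j"
    proof -
      have "(\<Sum>l\<le>Suc n. (deriv ^^ l) h (norm x) * L i j l x) =
        (\<Sum>l\<le>Suc n. (deriv ^^ l) h (norm x) * (case l of 0 \<Rightarrow> 0 | Suc l' \<Rightarrow> x $ s / norm x * K i j l' x)) +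
        (\<Sum>l\<le>Suc n. (deriv ^^ l) h (norm x) * (if l \<le> n then K' i j l x else M' i j x))"
        by (simp only: L_def distrib_left sum.distrib)
      \<comment> \<open>Index shift; the summand \<open>l = 0\<close> vanishes.\<close>
      also have "(\<Sum>l\<le>Suc n. (deriv ^^ l) h (norm x) * (case l of 0 \<Rightarrow> 0 | Suc l' \<Rightarrow> x $ s / norm x * K i j l' x))
        = (\<Sum>l\<le>n. (deriv ^^ Suc l) h (norm x) * (x $ s / norm x * K i j l x))"
        by (subst sum.atMost_Suc_shift) (simp del: funpow.simps)
      also have "(\<Sum>l\<le>Suc n. (deriv ^^ l) h (norm x) * (if l \<le> n then K' i j l x else M' i j x))
        = (\<Sum>l\<le>n. (deriv ^^ l) h (norm x) * K' i j l x) + (deriv ^^ Suc n) h (norm x) * M' i j x"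
        by (simp del: funpow.simps)
      finally show ?thesis by (simp add: D_def sum.distrib mult_ac del: funpow.simps)
    qed
    ultimately have "((\<lambda>t. (deriv ^^ Suc n) h (norm (x + t *\<^sub>R axis s 1)) * ?M i j (x + t *\<^sub>R axis s 1) +
        (\<Sum>l\<le>n. (deriv ^^ l) h (norm (x + t *\<^sub>R axis s 1)) * K i j l (x + t *\<^sub>R axis s 1)))
        has_real_derivative D x $ i $ j) (at 0)" by simp
    moreover have "open {t. x + t *\<^sub>R axis s 1 \<noteq> 0}"
      by (intro open_Collect_neq continuous_intros)
    ultimately show "((\<lambda>t. G (x + t *\<^sub>R axis s 1) $ i $ j) has_real_derivative D x $ i $ j) (at 0)"
      by (rule has_field_derivative_transform_within_open) (use x in \<open>auto simp: G_eq simp del: funpow.simps\<close>)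
  qed
  \<comment> \<open>On the small ball \<open>G\<close> is constant. This settles the origin, about
    which the formula with 1 / |x| says nothing.\<close>
  have near: "((\<lambda>t. G (x + t *\<^sub>R axis s 1)) has_vector_derivative 0) (at 0)" if x: "norm x < \<delta>" for x
  proof -
    have "((\<lambda>t. (if n = 0 then mat c else 0) :: real^'n^'n) has_vector_derivative 0) (at (0::real))"
      by (rule has_vector_derivative_const)
    moreover have "open {t. norm (x + t *\<^sub>R axis s 1) < \<delta>}"
      by (intro open_Collect_less continuous_intros)
    ultimately show ?thesis
      by (rule has_vector_derivative_transform_within_open) (use x in \<open>auto simp: G_near\<close>)
  qed
  have D: "partial_deriv s G x = D x" if "x \<noteq> 0" for x
    using vector_derivative_at[OF far[OF that]] by (simp add: partial_deriv_def)
  have D0: "partial_deriv s G x = 0" if "norm x < \<delta>" for x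
    using vector_derivative_at[OF near[OF that]] by (simp add: partial_deriv_def)
  show "((\<lambda>t. G (x + t *\<^sub>R axis s 1)) has_vector_derivative partial_deriv s G x) (at 0)"
    using far[of x] near[of x] D[of x] D0[of x] \<delta>_pos by (cases "x = 0") auto
  have "partial_deriv s G x $ i $ j = (deriv ^^ Suc (Suc n)) h (norm x) *
      ((\<Prod>s\<leftarrow>s # js. x $ s / norm x) * (x $ i / norm x * (x $ j / norm x))) +
      (\<Sum>l\<le>Suc n. (deriv ^^ l) h (norm x) * L i j l x)" if "x \<noteq> 0" for x i j
    by (simp add: D[OF that] D_def mult_ac del: funpow.simps sum.atMost_Suc)
  then show "partials_form (Suc n) (s # js) (partial_deriv s G)"
    unfolding partials_form_def
    by (intro conjI exI[of _ L] allI impI) (use L D0 in \<open>auto simp del: funpow.simps sum.atMost_Suc\<close>)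
qed

lemma partials_form_foldr:
  "length js \<le> k \<Longrightarrow> partials_form (length js) js (foldr partial_deriv js A)"
  by (induction js) (auto intro: partials_form_A partials_form_step(2))

text \<open>Partial derivatives commute with translation and with the bounded linear map of right
  multiplication by \<open>N\<close>. The bound on the length guarantees that each successive
  derivative exists.\<close>

lemma foldr_partial_deriv_shift:
  fixes N :: "real^'n::finite^'n"
  assumes "length js \<le> k"
  shows "foldr partial_deriv js (\<lambda>x. A (x + \<tau>) ** N) = (\<lambda>x. foldr partial_deriv js A (x + \<tau>) ** N)"
  using assms
proof (induction js)
  case (Cons s js)
  have "linear (\<lambda>X. X ** N)"
    by (intro linearI) (simp_all add: vec_eq_iff matrix_matrix_mult_def distrib_right sum.distrib sum_distrib_left mult.assoc)
  then have N: "bounded_linear (\<lambda>X. X ** N)" by (simp add: linear_conv_bounded_linear)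
  have "partial_deriv s (\<lambda>x. foldr partial_deriv js A (x + \<tau>) ** N) x =
      partial_deriv s (foldr partial_deriv js A) (x + \<tau>) ** N" for x
    unfolding partial_deriv_def[of s "\<lambda>x. foldr partial_deriv js A (x + \<tau>) ** N"]
  proof (rule vector_derivative_at)
    have "((\<lambda>t. foldr partial_deriv js A (x + \<tau> + t *\<^sub>R axis s 1) ** N) has_vector_derivative
        partial_deriv s (foldr partial_deriv js A) (x + \<tau>) ** N) (at 0)"
      using Cons.prems
      by (intro bounded_linear.has_vector_derivative[OF N] partials_form_step(1)[OF partials_form_foldr]) auto
    then show "((\<lambda>t. foldr partial_deriv js A (x + t *\<^sub>R axis s 1 + \<tau>) ** N) has_vector_derivative
        partial_deriv s (foldr partial_deriv js A) (x + \<tau>) ** N) (at 0)"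
      by (simp add: ac_simps)
  qed
  then show ?case using Cons by simp
qed simp

section \<open>Estimates at two points\<close>

lemma g_le: "g (norm \<sigma>) \<le> v (norm (\<sigma> - \<tau>)) * g (norm \<tau>)"
proof -
  \<comment> \<open>The one-dimensional shift |\<sigma>| - |\<tau>| has modulus at most |\<sigma> -
    \<tau>|, and \<open>v\<close> is radially increasing.\<close>
  have "g (norm \<sigma> - norm \<tau> + norm \<tau>) \<le> v (norm \<sigma> - norm \<tau>) * g (norm \<tau>)"
    by (rule g_moderate)
  also have "\<dots> \<le> v (norm (\<sigma> - \<tau>)) * g (norm \<tau>)"
    using g_pos[of "norm \<tau>"] norm_triangle_ineq3[of \<sigma> \<tau>] by (intro mult_right_mono v_mono) auto
  finally show ?thesis by simp
qed

lemma iterated_deriv_le: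
  assumes "1 \<le> l" "l \<le> Suc k"
  shows "\<bar>(deriv ^^ l) h (norm \<sigma>)\<bar> \<le> v (norm (\<sigma> - \<tau>)) * deriv h (norm \<tau>)"
proof -
  have "\<bar>(deriv ^^ l) h (norm \<sigma>)\<bar> \<le> v (norm \<sigma> - norm \<tau>) * deriv h (norm \<tau>)"
    using assms by (intro h_deriv_le) auto
  also have "\<dots> \<le> v (norm (\<sigma> - \<tau>)) * deriv h (norm \<tau>)"
    using h'_pos[of "norm \<tau>"] norm_triangle_ineq3[of \<sigma> \<tau>] by (intro mult_right_mono v_mono) auto
  finally show ?thesis .
qed

text \<open>Replacing \<open>deriv h\<close> by \<open>g\<close> at |\<tau>| costs a factor 1 +
  |\<tau>|, which division by |\<sigma>| reduces to a multiple of 1 + |\<sigma> - \<tau>|. The case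
  \<open>l = 0\<close> is separate, as the derivative bounds start at 1: there the quotient is
  \<open>g\<close> itself, and the \<open>+ 1\<close> makes the constant large enough.\<close>

lemma iterated_deriv_div_norm_le:
  assumes "l \<le> Suc k" and \<sigma>: "norm \<sigma> \<ge> \<delta>"
  shows "\<bar>(deriv ^^ l) h (norm \<sigma>)\<bar> / norm \<sigma> \<le>
    (C1 * (1 / \<delta> + 1) + 1) * (1 + norm (\<sigma> - \<tau>)) * v (norm (\<sigma> - \<tau>)) * g (norm \<tau>)"
proof -
  define s where "s = norm (\<sigma> - \<tau>)"
  have r: "norm \<sigma> > 0" using \<sigma> \<delta>_pos by linarith
  have s: "s \<ge> 0" by (simp add: s_def)
  have vg: "v s * g (norm \<tau>) > 0" using v_ge_1[of s] g_pos[of "norm \<tau>"] by simp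
  show ?thesis
  proof (cases "l = 0")
    case True
    have "\<bar>(deriv ^^ l) h (norm \<sigma>)\<bar> / norm \<sigma> = \<bar>g (norm \<sigma>)\<bar>"
      using True r by (simp add: g_eq)
    also have "\<dots> \<le> 1 * (v s * g (norm \<tau>))"
      using g_le[of \<sigma> \<tau>] g_pos[of "norm \<sigma>"] by (simp add: s_def)
    also have "\<dots> \<le> ((C1 * (1 / \<delta> + 1) + 1) * (1 + s)) * (v s * g (norm \<tau>))"
    proof (rule mult_right_mono)
      have "1 * 1 \<le> (C1 * (1 / \<delta> + 1) + 1) * (1 + s)"
        using C1_pos \<delta>_pos s by (intro mult_mono) auto
      then show "1 \<le> (C1 * (1 / \<delta> + 1) + 1) * (1 + s)" by simp
    qed (use vg in simp)
    finally show ?thesis by (simp add: s_def mult_ac)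
  next
    case False
    have "norm \<tau> \<le> norm \<sigma> + s"
      using norm_triangle_ineq3[of \<sigma> \<tau>] by (auto simp: s_def)
    then have "(1 + norm \<tau>) / norm \<sigma> \<le> (1 + norm \<sigma> + s) / norm \<sigma>"
      using r by (intro divide_right_mono) auto
    also have "\<dots> = (1 + s) * (1 / norm \<sigma>) + 1" using r by (simp add: field_simps)
    also have "\<dots> \<le> (1 + s) * (1 / \<delta>) + (1 + s)"
      using \<sigma> \<delta>_pos r s by (intro add_mono mult_left_mono divide_left_mono mult_pos_pos) auto
    finally have 1: "(1 + norm \<tau>) / norm \<sigma> \<le> (1 / \<delta> + 1) * (1 + s)" by (simp add: algebra_simps)
    have "\<bar>(deriv ^^ l) h (norm \<sigma>)\<bar> / norm \<sigma> \<le> (v s * deriv h (norm \<tau>)) / norm \<sigma>"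
      unfolding s_def using False assms(1) by (intro divide_right_mono iterated_deriv_le) auto
    also have "\<dots> \<le> (v s * (C1 * (1 + norm \<tau>) * g (norm \<tau>))) / norm \<sigma>"
      using v_ge_1[of s] by (intro divide_right_mono mult_left_mono h'_le') auto
    also have "\<dots> = (C1 * ((1 + norm \<tau>) / norm \<sigma>)) * (v s * g (norm \<tau>))" by simp
    also have "\<dots> \<le> (C1 * ((1 / \<delta> + 1) * (1 + s))) * (v s * g (norm \<tau>))"
      using 1 C1_pos vg by (intro mult_right_mono mult_left_mono) auto
    also have "\<dots> \<le> ((C1 * (1 / \<delta> + 1) + 1) * (1 + s)) * (v s * g (norm \<tau>))"
      using s vg by (intro mult_right_mono) (auto simp: algebra_simps)
    finally show ?thesis by (simp add: s_def mult_ac)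
  qed
qed

text \<open>Here \<open>z\<close> is the part of \<open>y\<close> orthogonal to \<tau>, on which
  \<open>B \<tau>\<close> acts by the tangential eigenvalue. For \<tau> = 0 the conventions give
  \<open>z = y\<close>.\<close>

lemma B_eq:
  fixes \<tau> y :: "real^'n::finite"
  defines "z \<equiv> y - (sgn \<tau> \<bullet> y) *\<^sub>R sgn \<tau>"
  shows "B \<tau> *v y = inverse (g (norm \<tau>)) *\<^sub>R z + (inverse (deriv h (norm \<tau>)) * (sgn \<tau> \<bullet> y)) *\<^sub>R sgn \<tau>"
    and "norm z \<le> norm y" and "\<tau> \<bullet> z = 0" and "\<bar>sgn \<tau> \<bullet> y\<bar> \<le> norm y"
proof -
  show "B \<tau> *v y = inverse (g (norm \<tau>)) *\<^sub>R z + (inverse (deriv h (norm \<tau>)) * (sgn \<tau> \<bullet> y)) *\<^sub>R sgn \<tau>"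
    by (simp add: B_def radial_matrix_vector_mult z_def algebra_simps)
  have sgn: "sgn \<tau> \<bullet> sgn \<tau> = (if \<tau> = 0 then 0 else 1)" by (simp add: dot_square_norm norm_sgn)
  have "z \<bullet> z \<le> y \<bullet> y"
    by (simp add: z_def inner_diff_left inner_diff_right sgn inner_commute)
  then show "norm z \<le> norm y" by (simp add: norm_le)
  have "\<tau> \<bullet> z = (norm \<tau> *\<^sub>R sgn \<tau>) \<bullet> z" by (simp only: norm_scaleR_sgn)
  also have "\<dots> = norm \<tau> * (sgn \<tau> \<bullet> z)" by simp
  also have "\<dots> = 0" by (simp add: z_def inner_diff_right sgn)
  finally show "\<tau> \<bullet> z = 0" .
  have "\<bar>sgn \<tau> \<bullet> y\<bar> \<le> norm (sgn \<tau>) * norm y" by (rule Cauchy_Schwarz_ineq2)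
  also have "\<dots> \<le> 1 * norm y" by (intro mult_right_mono) (auto simp: norm_sgn)
  finally show "\<bar>sgn \<tau> \<bullet> y\<bar> \<le> norm y" by simp
qed

text \<open>Both eigenvalues of \<open>B \<tau>\<close> are controlled by 1 / \<open>g\<close>: the
  radial one because \<open>deriv h\<close> is at least \<open>C0\<close> times
  \<open>g\<close>.\<close>

lemma norm_B_le: "norm (B \<tau> *v y) \<le> (1 + 1 / C0) / g (norm \<tau>) * norm y"
proof -
  let ?g = "g (norm \<tau>)" and ?f = "deriv h (norm \<tau>)"
  have g: "?g > 0" by (rule g_pos)
  have f: "?f > 0" by (rule h'_pos)
  define z where "z = y - (sgn \<tau> \<bullet> y) *\<^sub>R sgn \<tau>"
  have "norm (B \<tau> *v y) \<le> norm (inverse ?g *\<^sub>R z) + norm ((inverse ?f * (sgn \<tau> \<bullet> y)) *\<^sub>R sgn \<tau>)"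
    unfolding B_eq(1) z_def by (rule norm_triangle_ineq)
  also have "\<dots> \<le> inverse ?g * norm y + inverse ?f * norm y"
  proof (rule add_mono)
    show "norm (inverse ?g *\<^sub>R z) \<le> inverse ?g * norm y"
      using g B_eq(2)[of y \<tau>] by (simp add: z_def)
    have "inverse ?f * (\<bar>sgn \<tau> \<bullet> y\<bar> * norm (sgn \<tau>)) \<le> inverse ?f * (norm y * 1)"
      using f B_eq(4)[of \<tau> y] by (intro mult_left_mono mult_mono) (auto simp: norm_sgn)
    then show "norm ((inverse ?f * (sgn \<tau> \<bullet> y)) *\<^sub>R sgn \<tau>) \<le> inverse ?f * norm y"
      using f by (simp add: abs_mult mult_ac)
  qed
  also have "\<dots> \<le> inverse ?g * norm y + inverse (C0 * ?g) * norm y"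
    using h'_ge'[of "norm \<tau>"] C0_pos g by (intro add_left_mono mult_right_mono le_imp_inverse_le) auto
  also have "\<dots> = (1 + 1 / C0) / ?g * norm y"
    using C0_pos g by (simp add: field_simps)
  finally show ?thesis .
qed

text \<open>The estimate for the leading term. On the radial part of \<open>B \<tau> *v y\<close>
  the factor \<open>deriv h\<close> cancels. On the tangential part the quotient of
  \<open>deriv h\<close> by \<open>g\<close> may grow like 1 + |\<tau>|, but a vector orthogonal to
  \<tau> is nearly orthogonal to \<sigma> when \<sigma> is close to \<tau> relative to
  |\<sigma>|.\<close>

lemma inner_B_le:
  "deriv h (norm \<tau>) * \<bar>sgn \<sigma> \<bullet> (B \<tau> *v y)\<bar> \<le> (2 * C1 + 1) * (1 + norm (\<sigma> - \<tau>)) * norm y"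
proof -
  let ?g = "g (norm \<tau>)" and ?f = "deriv h (norm \<tau>)"
  define s where "s = norm (\<sigma> - \<tau>)"
  have s: "s \<ge> 0" by (simp add: s_def)
  have g: "?g > 0" by (rule g_pos)
  have f: "?f > 0" by (rule h'_pos)
  define z where "z = y - (sgn \<tau> \<bullet> y) *\<^sub>R sgn \<tau>"
  define w where "w = \<bar>sgn \<sigma> \<bullet> z\<bar>"
  have sgn_le: "\<bar>sgn \<sigma> \<bullet> x\<bar> \<le> norm x" for x by (rule B_eq(4))
  have w: "0 \<le> w" "w \<le> norm y"
    using sgn_le[of z] B_eq(2)[of y \<tau>] by (auto simp: w_def z_def)
  \<comment> \<open>Orthogonality of \<open>z\<close> and \<tau> allows \<sigma> to be replaced by
    \<sigma> - \<tau>. Keeping the factor |\<sigma>| on the left avoids a division, so \<sigma> = 0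
    is included.\<close>
  have "norm \<sigma> * w = \<bar>(norm \<sigma> *\<^sub>R sgn \<sigma>) \<bullet> z\<bar>" by (simp add: w_def abs_mult)
  also have "\<dots> = \<bar>(\<sigma> - \<tau>) \<bullet> z\<bar>" using B_eq(3)[of \<tau> y]
    by (simp only: norm_scaleR_sgn inner_diff_left z_def diff_zero)
  also have "\<dots> \<le> s * norm z" unfolding s_def by (rule Cauchy_Schwarz_ineq2)
  also have "\<dots> \<le> s * norm y" using s B_eq(2)[of y \<tau>] by (intro mult_left_mono) (auto simp: z_def)
  finally have rw: "norm \<sigma> * w \<le> s * norm y" .
  have "norm \<tau> \<le> norm \<sigma> + s"
    using norm_triangle_ineq3[of \<sigma> \<tau>] by (auto simp: s_def)
  then have "(1 + norm \<tau>) * w \<le> (1 + norm \<sigma> + s) * w" using w by (intro mult_right_mono) auto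
  also have "\<dots> = w + norm \<sigma> * w + s * w" by (simp add: algebra_simps)
  also have "\<dots> \<le> norm y + s * norm y + s * norm y"
    using rw w s by (intro add_mono mult_left_mono) auto
  also have "\<dots> \<le> 2 * (1 + s) * norm y" by (simp add: algebra_simps)
  finally have tw: "(1 + norm \<tau>) * w \<le> 2 * (1 + s) * norm y" .
  have "sgn \<sigma> \<bullet> (B \<tau> *v y) = inverse ?g * (sgn \<sigma> \<bullet> z) + inverse ?f * (sgn \<tau> \<bullet> y) * (sgn \<sigma> \<bullet> sgn \<tau>)"
    by (simp add: B_eq(1) z_def inner_add_right)
  also have "\<bar>\<dots>\<bar> \<le> inverse ?g * w + inverse ?f * (\<bar>sgn \<tau> \<bullet> y\<bar> * \<bar>sgn \<sigma> \<bullet> sgn \<tau>\<bar>)"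
    using g f by (intro order_trans[OF abs_triangle_ineq]) (simp add: abs_mult w_def mult_ac)
  also have "\<dots> \<le> inverse ?g * w + inverse ?f * (norm y * 1)"
  proof (intro add_left_mono mult_left_mono mult_mono)
    show "\<bar>sgn \<sigma> \<bullet> sgn \<tau>\<bar> \<le> 1" using sgn_le[of "sgn \<tau>"] by (simp add: norm_sgn split: if_splits)
  qed (use f B_eq(4) in auto)
  finally have "?f * \<bar>sgn \<sigma> \<bullet> (B \<tau> *v y)\<bar> \<le> ?f * (inverse ?g * w + inverse ?f * norm y)"
    using f by (intro mult_left_mono) auto
  also have "\<dots> = ?f * (w / ?g) + norm y" using f g by (simp add: field_simps)
  also have "\<dots> \<le> (C1 * (1 + norm \<tau>) * ?g) * (w / ?g) + norm y"
    using w g by (intro add_right_mono mult_right_mono h'_le') auto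
  also have "\<dots> = C1 * ((1 + norm \<tau>) * w) + norm y" using g by simp
  also have "\<dots> \<le> C1 * (2 * (1 + s) * norm y) + norm y"
    using tw C1_pos by (intro add_right_mono mult_left_mono) auto
  also have "\<dots> \<le> (2 * C1 + 1) * (1 + s) * norm y"
    using s by (simp add: algebra_simps)
  finally show ?thesis by (simp add: s_def)
qed

section \<open>Bounds for the partial derivatives composed with the inverse Jacobian\<close>

lemma partials_form_bound_far:
  fixes G :: "real^'n::finite \<Rightarrow> real^'n^'n"
  assumes G: "partials_form n js G" and n: "n \<le> k"
  shows "\<exists>C\<ge>0. \<forall>\<sigma> \<tau> y. norm \<sigma> \<ge> \<delta> \<longrightarrow>
    norm (G \<sigma> *v (B \<tau> *v y)) \<le> C * ((1 + norm (\<sigma> - \<tau>)) * v (norm (\<sigma> - \<tau>)) * norm y)"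
proof -
  obtain K where K: "\<And>i j l. decay (Suc 0) (K i j l)"
    and G_eq: "\<And>x i j. x \<noteq> 0 \<Longrightarrow> G x $ i $ j = (deriv ^^ Suc n) h (norm x) *
          ((\<Prod>s\<leftarrow>js. x $ s / norm x) * (x $ i / norm x * (x $ j / norm x))) +
          (\<Sum>l\<le>n. (deriv ^^ l) h (norm x) * K i j l x)"
    using G unfolding partials_form_def by blast
  have "\<forall>i j l. \<exists>E. E \<ge> 0 \<and> (\<forall>x. norm x \<ge> \<delta> \<longrightarrow> \<bar>K i j l x\<bar> \<le> E * inverse (norm x))"
    using decay_bound[OF K \<delta>_pos] by simp
  then obtain E where "\<forall>i j l. E i j l \<ge> 0 \<and> (\<forall>x. norm x \<ge> \<delta> \<longrightarrow> \<bar>K i j l x\<bar> \<le> E i j l * inverse (norm x))"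
    unfolding choice_iff by (elim exE)
  then have E: "\<And>i j l. E i j l \<ge> 0"
    "\<And>i j l x. norm x \<ge> \<delta> \<Longrightarrow> \<bar>K i j l x\<bar> \<le> E i j l * inverse (norm x)" by blast+
  define L where "L = C1 * (1 / \<delta> + 1) + 1"
  define T where "T = (\<Sum>i\<in>UNIV. \<Sum>j\<in>UNIV. \<Sum>l\<le>n. E i j l)"
  \<comment> \<open>The first summand is the constant of \<open>inner_B_le\<close> for the leading
    term. In the second, \<open>T\<close> collects the decay constants, \<open>L\<close> comes from
    \<open>iterated_deriv_div_norm_le\<close> and the last factor from
    \<open>norm_B_le\<close>.\<close>
  define C where "C = (2 * C1 + 1) + T * L * (1 + 1 / C0)"
  have L: "L \<ge> 0" using C1_pos \<delta>_pos by (simp add: L_def)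
  have T: "T \<ge> 0" by (simp add: T_def sum_nonneg E)
  have "C \<ge> 0" using C0_pos C1_pos T L by (simp add: C_def)
  moreover have "norm (G \<sigma> *v (B \<tau> *v y)) \<le> C * ((1 + norm (\<sigma> - \<tau>)) * v (norm (\<sigma> - \<tau>)) * norm y)"
    if \<sigma>: "norm \<sigma> \<ge> \<delta>" for \<sigma> \<tau> y :: "real^'n"
  proof -
    define S where "S = (1 + norm (\<sigma> - \<tau>)) * v (norm (\<sigma> - \<tau>))"
    define a where "a = (deriv ^^ Suc n) h (norm \<sigma>)"
    define b where "b = (\<Prod>s\<leftarrow>js. \<sigma> $ s / norm \<sigma>)"
    define R where "R = (\<chi> i j. \<Sum>l\<le>n. (deriv ^^ l) h (norm \<sigma>) * K i j l \<sigma>)"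
    let ?Y = "B \<tau> *v y"
    have \<sigma>0: "\<sigma> \<noteq> 0" using \<sigma> \<delta>_pos by auto
    have v: "v (norm (\<sigma> - \<tau>)) \<ge> 1" by (rule v_ge_1)
    have g: "g (norm \<tau>) > 0" by (rule g_pos)
    have S: "S \<ge> 0" using v by (simp add: S_def)
    \<comment> \<open>The leading term is a multiple of the projection onto the line through
      \<sigma>, so only the component of \<open>?Y\<close> along \<sigma> is seen by it.\<close>
    have "G \<sigma> = radial_matrix 0 (a * b) \<sigma> + R"
      using \<sigma>0 by (simp add: vec_eq_iff G_eq radial_matrix_def R_def a_def b_def mult_ac del: funpow.simps)
    then have "G \<sigma> *v ?Y = (a * b * (sgn \<sigma> \<bullet> ?Y)) *\<^sub>R sgn \<sigma> + R *v ?Y"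
      by (simp add: matrix_vector_mult_add_rdistrib radial_matrix_vector_mult)
    then have "norm (G \<sigma> *v ?Y) \<le> norm ((a * b * (sgn \<sigma> \<bullet> ?Y)) *\<^sub>R sgn \<sigma>) + norm (R *v ?Y)"
      by (simp only: norm_triangle_ineq)
    also have "norm ((a * b * (sgn \<sigma> \<bullet> ?Y)) *\<^sub>R sgn \<sigma>) \<le> (2 * C1 + 1) * (S * norm y)"
    proof -
      have dir: "\<bar>\<sigma> $ s / norm \<sigma>\<bar> \<le> 1" for s
        using component_le_norm_cart[of \<sigma> s] \<sigma>0 by (simp add: field_simps)
      have "\<bar>b\<bar> \<le> 1" unfolding b_def
      proof (induction js)
        case (Cons s js)
        have "\<bar>\<sigma> $ s / norm \<sigma>\<bar> * \<bar>\<Prod>s\<leftarrow>js. \<sigma> $ s / norm \<sigma>\<bar> \<le> 1"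
          by (rule mult_le_one[OF dir _ Cons]) simp
        then show ?case by (simp add: abs_mult)
      qed simp
      moreover have "\<bar>a\<bar> \<le> v (norm (\<sigma> - \<tau>)) * deriv h (norm \<tau>)"
        unfolding a_def by (rule iterated_deriv_le) (use n in auto)
      ultimately have "\<bar>a\<bar> * \<bar>b\<bar> * \<bar>sgn \<sigma> \<bullet> ?Y\<bar> \<le> v (norm (\<sigma> - \<tau>)) * deriv h (norm \<tau>) * 1 * \<bar>sgn \<sigma> \<bullet> ?Y\<bar>"
        using v h'_pos[of "norm \<tau>"] by (intro mult_right_mono mult_mono) auto
      also have "\<dots> = v (norm (\<sigma> - \<tau>)) * (deriv h (norm \<tau>) * \<bar>sgn \<sigma> \<bullet> ?Y\<bar>)" by simp
      also have "\<dots> \<le> v (norm (\<sigma> - \<tau>)) * ((2 * C1 + 1) * (1 + norm (\<sigma> - \<tau>)) * norm y)"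
        using v by (intro mult_left_mono inner_B_le) auto
      finally show ?thesis using \<sigma>0 by (simp add: norm_sgn abs_mult S_def mult_ac)
    qed
    also have "norm (R *v ?Y) \<le> T * L * (1 + 1 / C0) * (S * norm y)"
    proof -
      have R_le: "\<bar>R $ i $ j\<bar> \<le> (\<Sum>l\<le>n. E i j l) * (L * S * g (norm \<tau>))" for i j
      proof -
        have "\<bar>R $ i $ j\<bar> \<le> (\<Sum>l\<le>n. \<bar>(deriv ^^ l) h (norm \<sigma>) * K i j l \<sigma>\<bar>)"
          by (simp add: R_def sum_abs)
        also have "\<dots> \<le> (\<Sum>l\<le>n. E i j l * (L * S * g (norm \<tau>)))"
        proof (rule sum_mono)
          fix l assume l: "l \<in> {..n}"
          have "\<bar>(deriv ^^ l) h (norm \<sigma>) * K i j l \<sigma>\<bar> \<le> \<bar>(deriv ^^ l) h (norm \<sigma>)\<bar> * (E i j l * inverse (norm \<sigma>))"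
            unfolding abs_mult using E(2)[OF \<sigma>] by (intro mult_left_mono) auto
          also have "\<dots> = E i j l * (\<bar>(deriv ^^ l) h (norm \<sigma>)\<bar> / norm \<sigma>)" by (simp add: divide_inverse)
          also have "\<dots> \<le> E i j l * (L * (1 + norm (\<sigma> - \<tau>)) * v (norm (\<sigma> - \<tau>)) * g (norm \<tau>))"
            unfolding L_def using l n E(1) \<sigma> by (intro mult_left_mono iterated_deriv_div_norm_le) auto
          finally show "\<bar>(deriv ^^ l) h (norm \<sigma>) * K i j l \<sigma>\<bar> \<le> E i j l * (L * S * g (norm \<tau>))"
            by (simp add: S_def mult_ac)
        qed
        finally show ?thesis by (simp add: sum_distrib_right)
      qed
      have "norm (R *v ?Y) \<le> onorm ((*v) R) * norm ?Y"
        by (rule onorm) simp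
      also have "\<dots> \<le> (\<Sum>i\<in>UNIV. \<Sum>j\<in>UNIV. \<bar>R $ i $ j\<bar>) * norm ?Y"
        by (intro mult_right_mono onorm_le_matrix_component_sum) auto
      also have "\<dots> \<le> (\<Sum>i\<in>UNIV. \<Sum>j\<in>UNIV. (\<Sum>l\<le>n. E i j l) * (L * S * g (norm \<tau>))) *
          ((1 + 1 / C0) / g (norm \<tau>) * norm y)"
        by (intro mult_mono sum_mono R_le norm_B_le sum_nonneg mult_nonneg_nonneg)
          (use E(1) L S g in auto)
      also have "\<dots> = (T * (L * S * g (norm \<tau>))) * ((1 + 1 / C0) / g (norm \<tau>) * norm y)"
        by (simp only: T_def sum_distrib_right)
      also have "\<dots> = T * L * (1 + 1 / C0) * (S * norm y)"
        using g by simp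
      finally show ?thesis .
    qed
    finally show ?thesis by (simp add: C_def S_def algebra_simps)
  qed
  ultimately show ?thesis by blast
qed

text \<open>Inside the small ball \<open>G\<close> is 0 or \<open>c\<close> times the identity, and
  \<open>c\<close> is the value of \<open>g\<close> at |\<sigma>|, so moderateness of
  \<open>g\<close> cancels the norm of \<open>B \<tau>\<close>.\<close>

lemma partials_form_bound:
  fixes G :: "real^'n::finite \<Rightarrow> real^'n^'n"
  assumes G: "partials_form n js G" and n: "n \<le> k"
  shows "\<exists>C\<ge>0. \<forall>\<sigma> \<tau> y.
    norm (G \<sigma> *v (B \<tau> *v y)) \<le> C * ((1 + norm (\<sigma> - \<tau>)) * v (norm (\<sigma> - \<tau>)) * norm y)"
proof -
  obtain C where C: "C \<ge> 0" "\<And>\<sigma> \<tau> y. norm \<sigma> \<ge> \<delta> \<Longrightarrow>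
    norm (G \<sigma> *v (B \<tau> *v y)) \<le> C * ((1 + norm (\<sigma> - \<tau>)) * v (norm (\<sigma> - \<tau>)) * norm y)"
    using partials_form_bound_far[OF assms] by blast
  have near: "norm (G \<sigma> *v (B \<tau> *v y)) \<le> (1 + 1 / C0) * ((1 + norm (\<sigma> - \<tau>)) * v (norm (\<sigma> - \<tau>)) * norm y)"
    if \<sigma>: "norm \<sigma> < \<delta>" for \<sigma> \<tau> y :: "real^'n"
  proof -
    have g: "g (norm \<tau>) > 0" by (rule g_pos)
    have v: "v (norm (\<sigma> - \<tau>)) \<ge> 1" by (rule v_ge_1)
    have "mat c = radial_matrix c c \<sigma>" by (auto simp: mat_def radial_matrix_def vec_eq_iff)
    then have "norm (G \<sigma> *v (B \<tau> *v y)) \<le> c * norm (B \<tau> *v y)"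
      using G \<sigma> c_pos by (auto simp: partials_form_def radial_matrix_vector_mult)
    also have "\<dots> \<le> (v (norm (\<sigma> - \<tau>)) * g (norm \<tau>)) * ((1 + 1 / C0) / g (norm \<tau>) * norm y)"
      using g_le[of \<sigma> \<tau>] g_linear[of "norm \<sigma>"] \<sigma> c_pos by (intro mult_mono norm_B_le) auto
    also have "\<dots> = (1 + 1 / C0) * (1 * v (norm (\<sigma> - \<tau>)) * norm y)" using g by simp
    also have "\<dots> \<le> (1 + 1 / C0) * ((1 + norm (\<sigma> - \<tau>)) * v (norm (\<sigma> - \<tau>)) * norm y)"
      using C0_pos v by (intro mult_left_mono mult_right_mono) auto
    finally show ?thesis .
  qed
  have "norm (G \<sigma> *v (B \<tau> *v y)) \<le> (C + (1 + 1 / C0)) * ((1 + norm (\<sigma> - \<tau>)) * v (norm (\<sigma> - \<tau>)) * norm y)"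
    for \<sigma> \<tau> y :: "real^'n"
  proof -
    define S where "S = (1 + norm (\<sigma> - \<tau>)) * v (norm (\<sigma> - \<tau>)) * norm y"
    have "0 \<le> S" using v_ge_1[of "norm (\<sigma> - \<tau>)"] by (simp add: S_def)
    then have "0 \<le> C * S" "0 \<le> (1 + 1 / C0) * S" using C(1) C0_pos by simp_all
    moreover have "norm (G \<sigma> *v (B \<tau> *v y)) \<le> C * S \<or> norm (G \<sigma> *v (B \<tau> *v y)) \<le> (1 + 1 / C0) * S"
      unfolding S_def using C(2)[of \<sigma> \<tau> y] near[of \<sigma> \<tau> y] by linarith
    ultimately show ?thesis unfolding S_def[symmetric] distrib_right[of C] by linarith
  qed
  then show ?thesis using C(1) C0_pos by (intro exI[of _ "C + (1 + 1 / C0)"]) auto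
qed

text \<open>Only finitely many coordinate lists have length at most \<open>k\<close>, so the sum of
  their constants is uniform; adding 1 ensures \<open>C \<ge> 1\<close>.\<close>

lemma partials_bound:
  "\<exists>C\<ge>1. \<forall>js \<sigma> \<tau> y. length js \<le> k \<longrightarrow>
    norm (foldr partial_deriv js A \<sigma> *v (B \<tau> *v (y::real^'n::finite))) \<le>
    C * ((1 + norm (\<sigma> - \<tau>)) * v (norm (\<sigma> - \<tau>)) * norm y)"
proof -
  let ?J = "{js :: 'n list. set js \<subseteq> UNIV \<and> length js \<le> k}"
  have fin: "finite ?J" by (rule finite_lists_length_le) simp
  have "\<forall>js\<in>?J. \<exists>C\<ge>0. \<forall>\<sigma> \<tau> y. norm (foldr partial_deriv js A \<sigma> *v (B \<tau> *v (y::real^'n))) \<le>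
    C * ((1 + norm (\<sigma> - \<tau>)) * v (norm (\<sigma> - \<tau>)) * norm y)"
    using partials_form_bound[OF partials_form_foldr] by auto
  then obtain C where C: "\<And>js. js \<in> ?J \<Longrightarrow> C js \<ge> 0"
    "\<And>js \<sigma> \<tau> y. js \<in> ?J \<Longrightarrow> norm (foldr partial_deriv js A \<sigma> *v (B \<tau> *v (y::real^'n))) \<le>
    C js * ((1 + norm (\<sigma> - \<tau>)) * v (norm (\<sigma> - \<tau>)) * norm y)"
    unfolding bchoice_iff by blast
  have "norm (foldr partial_deriv js A \<sigma> *v (B \<tau> *v y)) \<le>
    (1 + sum C ?J) * ((1 + norm (\<sigma> - \<tau>)) * v (norm (\<sigma> - \<tau>)) * norm y)"
    if "length js \<le> k" for js and \<sigma> \<tau> y :: "real^'n"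
  proof -
    have "C js \<le> sum C ?J" using that fin C(1) by (intro member_le_sum) auto
    then have "C js * ((1 + norm (\<sigma> - \<tau>)) * v (norm (\<sigma> - \<tau>)) * norm y) \<le>
      (1 + sum C ?J) * ((1 + norm (\<sigma> - \<tau>)) * v (norm (\<sigma> - \<tau>)) * norm y)"
      using v_ge_1[of "norm (\<sigma> - \<tau>)"] by (intro mult_right_mono) auto
    then show ?thesis using C(2)[of js \<sigma> \<tau> y] that by simp
  qed
  moreover have "sum C ?J \<ge> 0" by (rule sum_nonneg) (rule C(1))
  then have "1 + sum C ?J \<ge> 1" by simp
  ultimately show ?thesis by blast
qed

section \<open>Determinant and admissibility\<close>

lemma det_A: "det (A (\<tau>::real^'n::finite)) = deriv h (norm \<tau>) * g (norm \<tau>) ^ (CARD('n) - 1)"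
  \<comment> \<open>At the origin both eigenvalues equal \<open>c\<close>, as
    \<open>det_radial_matrix\<close> demands.\<close>
  unfolding A_def by (rule det_radial_matrix) (use \<delta>_pos in \<open>auto simp: g_0 h'_linear\<close>)

text \<open>By symmetry of \<open>A\<close>, \<open>warping_phi\<close> is
  \<open>A (\<upsilon> + \<tau>) ** B \<tau>\<close>. The bound of \<open>partials_bound\<close> at
  \<sigma> = \<upsilon> + \<tau> depends on \<sigma> - \<tau> = \<upsilon> only, which makes it
  uniform in \<tau>.\<close>

lemma admissible_warping_if_inverse_\<Psi>:
  fixes \<Phi> :: "real^'n::finite \<Rightarrow> real^'n"
  assumes \<Phi>: "C_diff (Suc k) UNIV \<Phi>" "\<And>x. \<Phi> (\<Psi> x) = x" "\<And>x. \<Psi> (\<Phi> x) = x"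
  shows "inv_jacobian UNIV \<Phi> = A"
    and "\<exists>C\<ge>1. admissible_warping k UNIV \<Phi> (\<lambda>\<tau>. C * (1 + norm \<tau>) * v (norm \<tau>))"
proof -
  have inv: "inv_into UNIV \<Phi> = \<Psi>" using \<Phi>(2,3) by (intro inv_equality)
  have "bij \<Phi>" using \<Phi>(2,3) by (intro o_bij[of \<Psi>]) (auto simp: fun_eq_iff)
  then have diffeo: "C_diffeomorphism (k + 1) UNIV UNIV \<Phi>"
    using \<Phi>(1) \<Psi>_C_diff by (simp add: C_diffeomorphism_def inv del: C_diff.simps)
  have "frechet_derivative \<Psi> (at \<tau>) = (*v) (A \<tau>)" for \<tau> :: "real^'n"
    by (rule frechet_derivative_at[OF \<Psi>_has_derivative, symmetric])
  then show jac: "inv_jacobian UNIV \<Phi> = A"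
    by (intro ext) (simp add: inv_jacobian_def inv jacobian_def)
  have A_sym: "transpose (A \<tau>) = A \<tau>" for \<tau> :: "real^'n" by (simp add: A_def)
  obtain C where C: "C \<ge> 1" "\<And>js \<sigma> \<tau> (y::real^'n). length js \<le> k \<Longrightarrow>
    norm (foldr partial_deriv js A \<sigma> *v (B \<tau> *v y)) \<le>
    C * ((1 + norm (\<sigma> - \<tau>)) * v (norm (\<sigma> - \<tau>)) * norm y)"
    using partials_bound by blast
  have phi: "warping_phi UNIV \<Phi> \<tau> = (\<lambda>\<upsilon>. A (\<upsilon> + \<tau>) ** B \<tau>)" for \<tau>
    by (simp add: warping_phi_def jac A_sym matrix_inv_eqI[OF A_mult_B] fun_eq_iff)
  have "onorm ((*v) (multi_deriv \<alpha> (warping_phi UNIV \<Phi> \<tau>) \<upsilon>)) \<le> C * (1 + norm \<upsilon>) * v (norm \<upsilon>)"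
    if \<alpha>: "(\<Sum>i\<in>UNIV. \<alpha> i) \<le> k" for \<tau> \<upsilon> \<alpha>
  proof -
    obtain js where js: "length js = (\<Sum>i\<in>UNIV. \<alpha> i)"
      "multi_deriv \<alpha> (warping_phi UNIV \<Phi> \<tau>) = foldr partial_deriv js (warping_phi UNIV \<Phi> \<tau>)"
      by (rule multi_deriv_eq_foldr)
    have "multi_deriv \<alpha> (warping_phi UNIV \<Phi> \<tau>) \<upsilon> = foldr partial_deriv js A (\<upsilon> + \<tau>) ** B \<tau>"
      using foldr_partial_deriv_shift[of js \<tau> "B \<tau>"] js \<alpha> by (simp add: phi)
    then show ?thesis
      using C(2)[of js "\<upsilon> + \<tau>" \<tau>] js(1) \<alpha>
      by (intro onorm_le) (simp add: matrix_vector_mul_assoc[symmetric] mult_ac)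
  qed
  moreover have "0 < det (inv_jacobian UNIV \<Phi> \<tau>)" for \<tau>
    using g_pos h'_pos by (simp add: jac det_A)
  ultimately show "\<exists>C\<ge>1. admissible_warping k UNIV \<Phi> (\<lambda>\<tau>. C * (1 + norm \<tau>) * v (norm \<tau>))"
    using C(1) diffeo control_weight_radial[OF control C(1)]
    by (intro exI[of _ C]) (auto simp: admissible_warping_def)
qed

end

subsection \<open>The radial warping function\<close>

theorem corollary8p8:
  fixes \<rho> v :: "real \<Rightarrow> real" and k :: nat
  assumes "admissible_radial_component k \<rho> v"
    and "k \<ge> CARD('n::finite) + 1"
  shows "(\<exists>C\<ge>1. admissible_warping k UNIV (radial_warping \<rho> :: real^'n \<Rightarrow> real^'n)
             (\<lambda>\<tau>. C * (1 + norm \<tau>) * v (norm \<tau>))) \<and>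
         weight (\<lambda>\<tau>. det (inv_jacobian UNIV (radial_warping \<rho> :: real^'n \<Rightarrow> real^'n) \<tau>)) \<and>
         (\<forall>\<tau>. det (inv_jacobian UNIV (radial_warping \<rho> :: real^'n \<Rightarrow> real^'n) \<tau>) =
              deriv (inv \<rho>) (norm \<tau>) * radial_inv_quot \<rho> (norm \<tau>) ^ (CARD('n) - 1))"
proof -
  let ?h = "inv \<rho>" and ?g = "radial_inv_quot \<rho>"
  note adm = assms(1)[unfolded admissible_radial_component_def C_diffeomorphism_def]
  have mono: "strict_mono \<rho>" and bij: "bij \<rho>" and C\<rho>: "C_diff (Suc k) UNIV \<rho>" and Ch: "C_diff (Suc k) UNIV ?h"
    and odd: "\<rho> (- x) = - \<rho> x" for x
    using adm by (auto simp del: C_diff.simps)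
  obtain \<epsilon> c where \<epsilon>: "\<epsilon> > 0" and c: "c > 0" and near: "\<forall>\<xi>\<in>{-\<epsilon><..<\<epsilon>}. \<rho> \<xi> = c * \<xi>"
    using adm by blast
  have slope: "radial_slope \<rho> = c" by (rule radial_slope_eq[OF \<epsilon> near])
  obtain C0 C1 where C: "C0 > 0" "C1 > 0"
    "\<And>x. x > 0 \<Longrightarrow> C0 * ?g x \<le> deriv ?h x" "\<And>x. x > 0 \<Longrightarrow> deriv ?h x \<le> C1 * (1 + x) * ?g x"
    using adm by blast
  have mod: "moderate v (deriv ?h)" "moderate v ?g" and v: "control_weight v" using adm by auto
  have hbound: "\<bar>(deriv ^^ l) ?h x\<bar> \<le> v (x - y) * deriv ?h y"
    if "0 \<le> x" "0 \<le> y" "1 \<le> l" "l \<le> Suc k" for x y l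
    using adm that by auto
  have h\<rho>: "?h (\<rho> x) = x" and \<rho>h: "\<rho> (?h x) = x" for x
    using bij by (simp_all add: bij_is_inj bij_is_surj surj_f_inv_f)
  have \<rho>0: "\<rho> 0 = 0" using odd[of 0] by simp
  \<comment> \<open>Near the origin \<open>\<rho>\<close> multiplies by \<open>c\<close>, so its
    inverse divides by \<open>c\<close> on the image interval of radius
    \<open>c * \<epsilon>\<close>.\<close>
  interpret radial_profile ?h ?g v k "c * \<epsilon>" "inverse c" C0 C1
  proof
    show "C_diff (Suc k) UNIV ?h" by (rule Ch)
    show "?h x = inverse c * x" if "\<bar>x\<bar> < c * \<epsilon>" for x
    proof -
      have "\<bar>inverse c * x\<bar> < \<epsilon>" using that c by (simp add: abs_mult field_simps)
      then have "\<rho> (inverse c * x) = x" using near c by (auto simp: abs_less_iff)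
      then show ?thesis using h\<rho> by metis
    qed
    show "?g 0 = inverse c" by (simp add: radial_inv_quot_def slope)
    show "?g x = ?h x / x" if "x \<noteq> 0" for x using that by (simp add: radial_inv_quot_def)
    show "?g x > 0" "deriv ?h x > 0" for x using mod by (simp_all add: moderate_def weight_def)
    show "?g (x + y) \<le> v x * ?g y" for x y using mod(2) by (simp add: moderate_def)
    show "\<bar>(deriv ^^ l) ?h x\<bar> \<le> v (x - y) * deriv ?h y"
      if "0 \<le> x" "0 \<le> y" "1 \<le> l" "l \<le> Suc k" for x y l
      using that by (rule hbound)
  qed (use \<epsilon> c C v in auto)
  let ?\<Phi> = "radial_warping \<rho> :: real^'n \<Rightarrow> real^'n"
  have "C_diff (Suc k) UNIV (\<lambda>x::real^'n. radial_quot \<rho> (norm x) *\<^sub>R x)"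
    by (rule C_diff_radial[OF C\<rho> _ \<epsilon>, where c = c]) (use near slope in \<open>auto simp: radial_quot_def\<close>)
  then have \<Phi>: "C_diff (Suc k) UNIV ?\<Phi>" by (simp add: radial_warping_def[abs_def])
  have \<Phi>\<Psi>: "?\<Phi> (\<Psi> x) = x" for x
  proof (cases "x = 0")
    case False
    \<comment> \<open>Radial maps act on norms through their profiles, so this composition reduces
      to \<open>\<rho>h\<close>. Positivity of \<open>g\<close> removes the absolute value.\<close>
    have "norm (\<Psi> x) = ?h (norm x)"
      using False g_pos[of "norm x"] by (simp add: \<Psi>_def) (simp add: g_eq)
    moreover have "?h (norm x) \<noteq> 0" using False \<rho>h[of "norm x"] \<rho>0 by auto
    ultimately show ?thesis using False
      by (simp add: radial_warping_def radial_quot_def \<rho>h) (simp add: \<Psi>_def g_eq)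
  qed (simp add: \<Psi>_def radial_warping_def)
  have \<Psi>\<Phi>: "\<Psi> (?\<Phi> x) = x" for x
  proof (cases "x = 0")
    case False
    \<comment> \<open>Plays the same part in the other direction: |\<rho>(|x|)| is
      \<rho>(|x|).\<close>
    then have pos: "\<rho> (norm x) > 0" using strict_monoD[OF mono, of 0 "norm x"] \<rho>0 by simp
    then have "norm (?\<Phi> x) = \<rho> (norm x)"
      using False by (simp add: radial_warping_def radial_quot_def)
    then show ?thesis using False pos
      by (simp add: \<Psi>_def g_eq h\<rho>) (simp add: radial_warping_def radial_quot_def)
  qed (simp add: \<Psi>_def radial_warping_def)
  note result = admissible_warping_if_inverse_\<Psi>[OF \<Phi> \<Phi>\<Psi> \<Psi>\<Phi>]
  have det: "det (inv_jacobian UNIV ?\<Phi> \<tau>) = deriv ?h (norm \<tau>) * ?g (norm \<tau>) ^ (CARD('n) - 1)" for \<tau>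
    by (simp add: result(1) det_A)
  have "?g \<in> borel_measurable borel" "deriv ?h \<in> borel_measurable borel"
    using mod by (simp_all add: moderate_def weight_def)
  then have "(\<lambda>\<tau>::real^'n. deriv ?h (norm \<tau>) * ?g (norm \<tau>) ^ (CARD('n) - 1)) \<in> borel_measurable borel"
    by measurable
  then have "weight (\<lambda>\<tau>. det (inv_jacobian UNIV ?\<Phi> \<tau>))"
    using g_pos h'_pos by (simp add: weight_def det)
  with result(2) det show ?thesis by blast
qed

end
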